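(* Let $(F,H,p_0)$ be a full $\mathcal H$-vertex algebra such that $(\Omega_{F,H})^\alpha_{t,\bar t}=0$ for all $\alpha\in H$ and all $t,\bar t\in\mathbb R$ with $t<0$ or $\bar t<0$. If $F$ is positive and compact, then every current-current deformation $F_{\sigma\cdot p_0}$ of $F$ ($\sigma\in O(H;\mathbb R)$) is also positive and compact.
   Context: **Formal series.** The base field is $\mathbb C$. $z,\bar z$ are independent formal variables (also used for a complex number and its conjugate), $\underline z=(z,\bar z)$, and by convention $|z|:=z\bar z$, so $|z|^r=z^r\bar z^r$. For a vector space $W$: $W[[z,\bar z,|z|^{\mathbb R}]]$ is the space of formal sums $\sum_{s,\bar s\in\mathbb R}a_{s,\bar s}z^s\bar z^{\bar s}$ with $a_{s,\bar s}\in W$ and $a_{s,\bar s}=0$ unless $s-\bar s\in\mathbb Z$; $W[[z,\bar z]]$ is the subspace of sums over $s,\bar s\in\mathbb Z_{\ge0}$; $W((z,\bar z,|z|^{\mathbb R}))$ is the subspace of series such that (i) there is $N\in\mathbb R$ with $a_{s,\bar s}=0$ if $s\le N$ or $\bar s\le N$, and (ii) for every $R\in\mathbb R$ the set $\{(s,\bar s): a_{s,\bar s}\ne0,\ s+\bar s\le R\}$ is finite. A series in $\mathbb C((z,\bar z,|z|^{\mathbb R}))$ is absolutely convergent around $0$ if, after multiplication by some $|z|^N$ making all exponents nonnegative, $\sum|a_{s,\bar s}|R^{s+\bar s}<\infty$ for some $R>0$. **Correlation functions.** $F_{0,1,\infty}$ is the space of complex-valued real analytic functions $f$ on $\mathbb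 CP^1\setminus\{0,1,\infty\}$ with conformal singularities at $0,1,\infty$: for each $\alpha\in\{0,1,\infty\}$ and each chart $\chi$ (biholomorphism from a neighbourhood of $\alpha$ to an open subset of $\mathbb C$, $\chi(\alpha)=0$) there is a series in $\mathbb C((z,\bar z,|z|^{\mathbb R}))$, absolutely convergent around $0$, converging to $f\circ\chi^{-1}(z)$ on a punctured disc at $0$; this (unique) series is denoted $j(\chi,f)$. Let $Y_2=\{(z_1,z_2)\in\mathbb C^2: z_1\ne z_2,z_1\ne0,z_2\neq0\}$ and let $\mathrm{GCor}_2$ be the span of the functions $\mu=z_1^\alpha\bar z_1^\beta f(z_2/z_1)$ on $Y_2$, $f\in F_{0,1,\infty}$, $\alpha,\beta\in\mathbb R$, $\alpha-\beta\in\mathbb Z$. Its expansions are (with $z_0=z_1-z_2$): $\mu|_{|z_1|>|z_2|}=z_1^\alpha\bar z_1^\beta\,j(z,f)|_{z=z_2/z_1}$; $\mu|_{|z_2|>|z_1|}=z_1^\alpha\bar z_1^\beta\,j(z^{-1},f)|_{z=z_1/z_2}$; $\mu|_{|z_2|>|z_1-z_2|}=z_2^\alpha\bar z_2^\beta\sum_{i,k\ge0}\binom\alpha i\binom\beta k(z_0/z_2)^i(\bar z_0/\bar z_2)^k\,j(1-z^{-1},f)|_{z=-z_0/z_2}$, where $z\mapsto -z_0/z_2$ sends $z^s\bar z^{\bar s}$ to $(-1)^{s-\bar s}(z_0/z_2)^s(\bar z_0/\bar z_2)^{\bar s}$. **Full vertex algebra.** An $\mathbb R^2$-graded vector space $F=\bigoplus_{h,\bar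 h\in\mathbb R}F_{h,\bar h}$ with a linear map $Y(-,\underline z):F\to\mathrm{End}(F)[[z,\bar z,|z|^{\mathbb R}]]$, $Y(a,\underline z)=\sum_{r,s\in\mathbb R}a(r,s)z^{-r-1}\bar z^{-s-1}$, and $\mathbf 1\in F_{0,0}$ such that, with $F^\vee=\bigoplus F_{h,\bar h}^*$: (FV1) $Y(a,\underline z)b\in F((z,\bar z,|z|^{\mathbb R}))$; (FV2) $F_{h,\bar h}=0$ unless $h-\bar h\in\mathbb Z$; (FV3) $Y(a,\underline z)\mathbf 1\in F[[z,\bar z]]$ with constant term $a(-1,-1)\mathbf 1=a$; (FV4) $Y(\mathbf 1,\underline z)=\mathrm{id}$; (FV5) for all $a,b,c\in F$, $u\in F^\vee$ there is $\mu\in\mathrm{GCor}_2$ with $u(Y(a,\underline z_1)Y(b,\underline z_2)c)=\mu|_{|z_1|>|z_2|}$, $u(Y(Y(a,\underline z_0)b,\underline z_2)c)=\mu|_{|z_2|>|z_1-z_2|}$, $u(Y(b,\underline z_2)Y(a,\underline z_1)c)=\mu|_{|z_2|>|z_1|}$; (FV6) for $a\in F_{h,\bar h}$, $a(r,s)F_{h',\bar h'}\subset F_{h+h'-r-1,\bar h+\bar h'-s-1}$. Put $Da=a(-2,-1)\mathbf 1$, $\bar Da=a(-1,-2)\mathbf 1$. $F$ is compact if (bounded below) there is $N\in\mathbb R$ with $F_{h,\bar h}=0$ for $h\le N$ or $\bar h\le N$, and (discrete) for every $K\in\mathbb R$, $\sum_{h+\bar h<K}\dim F_{h,\bar h}<\infty$.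 **Full $\mathcal H$-vertex algebra.** Let $H_l,H_r$ be finite-dimensional real vector spaces with nondegenerate symmetric bilinear forms $(-,-)_l,(-,-)_r$; $H=H_l\oplus H_r$, with projections $p_0,\bar p_0$ onto $H_l,H_r$. $M_{H,p_0}$ is the tensor product of the Heisenberg vertex algebra of $(H_l,(-,-)_l)$ and the conjugate (roles of $z,\bar z$ exchanged) of the Heisenberg vertex algebra of $(H_r,(-,-)_r)$. A full $\mathcal H$-vertex algebra $(F,H,p_0)$ is a full vertex algebra $F$ with a subalgebra $M_{H,p_0}\subset F$, i.e. with $H_l\subset F_{1,0}$, $H_r\subset F_{0,1}$ such that $\bar DH_l=0$, $DH_r=0$, $h_l(1,-1)h_l'=(h_l,h_l')_l\mathbf 1$, $h_r(-1,1)h_r'=(h_r,h_r')_r\mathbf 1$, and $h_l(n,-1)h_l'=0$, $h_r(-1,n)h_r'=0$ for $n=0$ or $n\ge2$; write $h_l(n)=h_l(n,-1)$, $h_r(n)=h_r(-1,n)$, extended linearly to $h(n)$, $h\in H$. It is required that (FH1) all $h_l(0),h_r(0)$ are semisimple on $F$ with real eigenvalues; (FH2) for each $\alpha\in H$ there is $N\in\mathbb R$ with $F^\alpha_{t,\bar t}=0$ if $t\le N$ or $\bar t\le N$, where $F^\alpha_{t,\bar t}=\{v\in F_{t,\bar t}: h_l(0)v=(h_l,p_0\alpha)_lv,\ h_r(0)v=(h_r,\bar p_0\alpha)_rv\ \text{for all } h_l,h_r\}$. It is positive if both $(H_l,(-,-)_l)$ and $(H_r,(-,-)_r)$ are positive-definite.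 **Vacuum space.** $\Omega^\alpha_{F,H}$ is the set of $v\in F$ with $h_l(n)v=h_r(n)v=0$ for $n\ge1$ and $h_l(0)v=(h_l,p_0\alpha)_lv$, $h_r(0)v=(h_r,\bar p_0\alpha)_rv$ for all $h_l,h_r$; $\Omega_{F,H}=\bigoplus_{\alpha\in H}\Omega^\alpha_{F,H}$; $(\Omega_{F,H})^\alpha_{t,\bar t}=F_{t+\frac12(p_0\alpha,p_0\alpha)_l,\bar t+\frac12(\bar p_0\alpha,\bar p_0\alpha)_r}\cap\Omega^\alpha_{F,H}$. $H$ carries the form $(\alpha,\beta)_{\mathrm{lat}}=(p_0\alpha,p_0\beta)_l-(\bar p_0\alpha,\bar p_0\beta)_r$, with orthogonal group $O(H;\mathbb R)$. For $v\in\Omega^\alpha_{F,H}$, $\hat Y(v,\underline z)=E^-(-\alpha,\underline z)Y(v,\underline z)E^+(-\alpha,\underline z)z^{(-p_0\alpha)(0)}\bar z^{(-\bar p_0\alpha)(0)}$ restricted to $\Omega_{F,H}$, where $E^\pm(\alpha,\underline z)=\exp\bigl(\mp\sum_{n\ge1}\frac{(p_0\alpha)(\pm n)}nz^{\mp n}+\frac{(\bar p_0\alpha)(\pm n)}n\bar z^{\mp n}\bigr)$ and $z^{(p_0\alpha)(0)}\bar z^{(\bar p_0\alpha)(0)}$ acts on $\Omega^\beta_{F,H}$ by $z^{(p_0\alpha,p_0\beta)_l}\bar z^{(\bar p_0\alpha,\bar p_0\beta)_r}$. **Deformation.** For $\sigma\in O(H;\mathbb R)$ let $p=\sigma\cdot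 p_0=\sigma p_0\sigma^{-1}$, $\bar p=1-p$ and $(h,h')_p=(ph,ph')_{\mathrm{lat}}-(\bar ph,\bar ph')_{\mathrm{lat}}$. Let $h(n)$ generate the Heisenberg algebra $[h(m),h'(n)]=m(h,h')_p\delta_{m+n,0}$ and let $G_{H,p}=\bigoplus_{\alpha\in H}M_{H,p}(\alpha)$, with $M_{H,p}(\alpha)$ the complex Fock module generated by $e_\alpha$, $h(n)e_\alpha=0$ ($n\ge1$), $h(0)e_\alpha=(h,\alpha)_pe_\alpha$. $(G_{H,p})^\alpha_{t,\bar t}$ is spanned by $h^1(-i_1)\cdots h^k(-i_k)g^1(-j_1)\cdots g^m(-j_m)e_\alpha$ ($h^a\in\ker\bar p$, $g^b\in\ker p$, $i_a,j_b\ge1$) with $t=\frac12(p\alpha,p\alpha)_p+\sum i_a$, $\bar t=\frac12(\bar p\alpha,\bar p\alpha)_p+\sum j_b$. Vertex operators: $\hat Y(e_\alpha,\underline z)=E^-(\alpha,\underline z)E^+(\alpha,\underline z)l_{e_\alpha}z^{p\alpha}\bar z^{\bar p\alpha}$ where now, on $G_{H,p}$, $E^\pm(\alpha,\underline z)=\exp\bigl(\mp\sum_{n\ge1}\bigl(\frac{(p\alpha)(\pm n)}nz^{\mp n}+\frac{(\bar p\alpha)(\pm n)}n\bar z^{\mp n}\bigr)\bigr)$, $l_{e_\alpha}(xe_\beta)=xe_{\alpha+\beta}$ ($x$ a polynomial in the $h(-n)$, $n\ge1$), $z^{p\alpha}\bar z^{\bar p\alpha}=z^{(p\alpha,p\beta)_p}\bar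 z^{(\bar p\alpha,\bar p\beta)_p}$ on $M_{H,p}(\beta)$; inductively, for $h\in\ker\bar p$, $\hat Y(h(-n-1)v,\underline z)=(\frac1{n!}\partial_z^nh^-(z))\hat Y(v,\underline z)+\hat Y(v,\underline z)(\frac1{n!}\partial_z^nh^+(z))$, $h^+(z)=\sum_{k\ge0}h(k)z^{-k-1}$, $h^-(z)=\sum_{k\ge0}h(-k-1)z^k$, and the same with $\bar z$ for $h\in\ker p$. Then $F_p=\bigoplus_{\alpha\in H}M_{H,p}(\alpha)\otimes\Omega^\alpha_{F,H}$, with $Y(a\otimes b,\underline z)=\hat Y(a,\underline z)\otimes\hat Y(b,\underline z)$, vacuum $e_0\otimes\mathbf 1$, the sum grading $(F_p)_{h,\bar h}=\bigoplus_\alpha\bigoplus_{s,\bar s}(G_{H,p})^\alpha_{s,\bar s}\otimes(\Omega_{F,H})^\alpha_{h-s,\bar h-\bar s}$, and the Heisenberg subalgebra $M_{H,p}(0)\otimes\mathbb C\mathbf 1$ (with left and right spaces $\ker\bar p$, $\ker p$ equipped with $(-,-)_p$), is a full $\mathcal H$-vertex algebra. The family $\{F_{\sigma\cdot p_0}\}_{\sigma\in O(H;\mathbb R)}$ is the current-current deformation of $F$. *)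

theory Defs
  imports "HOL-Analysis.Analysis" "HOL-Library.Poly_Mapping"
begin

section \<open>Formal series with real exponents\<close>

text \<open>
  A formal series \<open>\<Sum> a\<^sub>s\<^sub>t z\<^sup>s zbar\<^sup>t\<close> over pairs of real exponents is its coefficient function
  \<open>a s t\<close>. The predicate \<open>conf_series\<close> carves out \<open>W((z, zbar, |z|\<^sup>R))\<close>.
\<close>

definition conf_series :: "(real \<Rightarrow> real \<Rightarrow> 'w::zero) \<Rightarrow> bool" where
  "conf_series a \<longleftrightarrow>
     (\<forall>s t. a s t \<noteq> 0 \<longrightarrow> s - t \<in> \<int>) \<and>
     (\<exists>N. \<forall>s t. s \<le> N \<or> t \<le> N \<longrightarrow> a s t = 0) \<and>
     (\<forall>R. finite {(s, t). a s t \<noteq> 0 \<and> s + t \<le> R})"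

definition abs_conv0 :: "(real \<Rightarrow> real \<Rightarrow> complex) \<Rightarrow> bool" where
  "abs_conv0 a \<longleftrightarrow>
     (\<exists>N. (\<forall>s t. a s t \<noteq> 0 \<longrightarrow> 0 \<le> s + N \<and> 0 \<le> t + N) \<and>
       (\<exists>R>0. (\<lambda>(s, t). cmod (a s t) * R powr ((s + N) + (t + N))) summable_on UNIV))"

text \<open>
  The value \<open>z\<^sup>s zbar\<^sup>t\<close> at a complex number \<open>z \<noteq> 0\<close>, for \<open>s - t\<close> an integer: with
  \<open>z = r e\<^sup>i\<^sup>x\<close> it is \<open>r\<^sup>s\<^sup>+\<^sup>t e\<^sup>i\<^sup>x\<^sup>(\<^sup>s\<^sup>-\<^sup>t\<^sup>)\<close>.
\<close>

definition zpow :: "complex \<Rightarrow> real \<Rightarrow> real \<Rightarrow> complex" where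
  "zpow z s t = complex_of_real (cmod z powr (s + t)) * sgn z powi \<lfloor>s - t\<rfloor>"

section \<open>Functions on the projective line with conformal singularities\<close>

definition real_analytic_on :: "(complex \<Rightarrow> complex) \<Rightarrow> complex set \<Rightarrow> bool" where
  "real_analytic_on f U \<longleftrightarrow>
     (\<forall>w\<in>U. \<exists>c. \<exists>r>0. \<forall>z\<in>ball w r.
       ((\<lambda>(m::nat, n::nat). c m n * of_real (Re (z - w)) ^ m * of_real (Im (z - w)) ^ n)
          has_sum f z) UNIV)"

text \<open>
  A point \<open>\<alpha>\<close> of the projective line is represented by its filter of punctured neighbourhoods:
  \<open>at \<alpha>\<close> for a finite point, \<open>at_infinity\<close> for infinity. A chart \<open>\<kappa>\<close> at \<open>\<alpha>\<close> with \<open>\<kappa>(\<alpha>) = 0\<close> is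
  represented by its restriction to the punctured domain: since the singularity is removable with
  value 0, an injective holomorphic function tending to 0 at \<open>\<alpha>\<close> is the same as a chart.
\<close>

definition chart_at :: "complex filter \<Rightarrow> (complex \<Rightarrow> complex) \<Rightarrow> bool" where
  "chart_at A \<kappa> \<longleftrightarrow>
     (\<exists>U. open U \<and> eventually (\<lambda>z. z \<in> U) A \<and> \<kappa> holomorphic_on U \<and> inj_on \<kappa> U) \<and>
     (\<kappa> \<longlongrightarrow> 0) A"

text \<open>
  The series \<open>a\<close> converges to \<open>f \<circ> \<kappa>\<^sup>-\<^sup>1\<close> on a punctured disc at 0; equivalently its value at
  \<open>\<kappa> z\<close> is \<open>f z\<close> for \<open>z\<close> in a punctured neighbourhood of the point.
\<close>

definition conf_expansion ::
  "complex filter \<Rightarrow> (complex \<Rightarrow> complex) \<Rightarrow> (complex \<Rightarrow> complex) \<Rightarrow> (real \<Rightarrow> real \<Rightarrow> complex) \<Rightarrow> bool"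
where
  "conf_expansion A \<kappa> f a \<longleftrightarrow> conf_series a \<and> abs_conv0 a \<and>
     eventually (\<lambda>z. ((\<lambda>(s, t). a s t * zpow (\<kappa> z) s t) has_sum f z) UNIV) A"

definition j_exp ::
  "complex filter \<Rightarrow> (complex \<Rightarrow> complex) \<Rightarrow> (complex \<Rightarrow> complex) \<Rightarrow> real \<Rightarrow> real \<Rightarrow> complex" where
  "j_exp A \<kappa> f = (THE a. conf_expansion A \<kappa> f a)"

definition F01inf :: "(complex \<Rightarrow> complex) set" where
  "F01inf = {f. real_analytic_on f (- {0, 1}) \<and>
     (\<forall>A \<in> {at 0, at 1, at_infinity}. \<forall>\<kappa>. chart_at A \<kappa> \<longrightarrow> (\<exists>a. conf_expansion A \<kappa> f a))}"

definition Y2 :: "(complex \<times> complex) set" where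
  "Y2 = {(z1, z2). z1 \<noteq> z2 \<and> z1 \<noteq> 0 \<and> z2 \<noteq> 0}"

text \<open>
  \<open>gcor2_rep L \<mu>\<close>: the list \<open>L\<close> presents \<open>\<mu>\<close> as a linear combination of generators
  \<open>z\<^sub>1\<^sup>\<alpha> zbar\<^sub>1\<^sup>\<beta> f(z\<^sub>2/z\<^sub>1)\<close>; scalars are absorbed into \<open>f\<close>. The expansions of \<open>\<mu>\<close> are the linear
  extensions of those of the generators; they do not depend on the presentation.
\<close>

definition gcor2_rep ::
  "(real \<times> real \<times> (complex \<Rightarrow> complex)) list \<Rightarrow> (complex \<Rightarrow> complex \<Rightarrow> complex) \<Rightarrow> bool" where
  "gcor2_rep L \<mu> \<longleftrightarrow>
     (\<forall>(\<alpha>, \<beta>, f) \<in> set L. \<alpha> - \<beta> \<in> \<int> \<and> f \<in> F01inf) \<and>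
     (\<forall>(z1, z2) \<in> Y2. \<mu> z1 z2 = (\<Sum>(\<alpha>, \<beta>, f)\<leftarrow>L. zpow z1 \<alpha> \<beta> * f (z2 / z1)))"

definition GCor2 :: "(complex \<Rightarrow> complex \<Rightarrow> complex) set" where
  "GCor2 = {\<mu>. \<exists>L. gcor2_rep L \<mu>}"

type_synonym series4 = "real \<Rightarrow> real \<Rightarrow> real \<Rightarrow> real \<Rightarrow> complex"

text \<open>
  \<open>S s t s' t'\<close> is the coefficient of \<open>z\<^sub>1\<^sup>s zbar\<^sub>1\<^sup>t z\<^sub>2\<^sup>s\<^sup>' zbar\<^sub>2\<^sup>t\<^sup>'\<close> in the first two expansions and of
  \<open>z\<^sub>0\<^sup>s zbar\<^sub>0\<^sup>t z\<^sub>2\<^sup>s\<^sup>' zbar\<^sub>2\<^sup>t\<^sup>'\<close> in the third.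
\<close>

definition expands_12 :: "(complex \<Rightarrow> complex \<Rightarrow> complex) \<Rightarrow> series4 \<Rightarrow> bool" where
  "expands_12 \<mu> S \<longleftrightarrow> (\<exists>L. gcor2_rep L \<mu> \<and>
     S = (\<lambda>s t s' t'. \<Sum>(\<alpha>, \<beta>, f)\<leftarrow>L.
            if s + s' = \<alpha> \<and> t + t' = \<beta> then j_exp (at 0) (\<lambda>z. z) f s' t' else 0))"

definition expands_21 :: "(complex \<Rightarrow> complex \<Rightarrow> complex) \<Rightarrow> series4 \<Rightarrow> bool" where
  "expands_21 \<mu> S \<longleftrightarrow> (\<exists>L. gcor2_rep L \<mu> \<and>
     S = (\<lambda>s t s' t'. \<Sum>(\<alpha>, \<beta>, f)\<leftarrow>L.
            if s + s' = \<alpha> \<and> t + t' = \<beta>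
            then j_exp at_infinity (\<lambda>z. inverse z) f (- s') (- t') else 0))"

definition expands_20 :: "(complex \<Rightarrow> complex \<Rightarrow> complex) \<Rightarrow> series4 \<Rightarrow> bool" where
  "expands_20 \<mu> S \<longleftrightarrow> (\<exists>L. gcor2_rep L \<mu> \<and>
     S = (\<lambda>s t s' t'. \<Sum>(\<alpha>, \<beta>, f)\<leftarrow>L.
            if s + s' = \<alpha> \<and> t + t' = \<beta>
            then Sum_any (\<lambda>(i::nat, k::nat).
                   of_real (\<alpha> gchoose i) * of_real (\<beta> gchoose k) *
                   (- 1) powi \<lfloor>(s - real i) - (t - real k)\<rfloor> *
                   j_exp (at 1) (\<lambda>z. 1 - inverse z) f (s - real i) (t - real k))
            else 0))"

section \<open>Full vertex algebras\<close>

text \<open>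
  The complex vector space \<open>F\<close> is a subspace \<open>carr\<close> of an ambient complex vector space with scalar
  multiplication \<open>scal\<close>; \<open>Ycoeff a s t b\<close> is the coefficient of \<open>z\<^sup>s zbar\<^sup>t\<close> in \<open>Y(a, z) b\<close>.
\<close>

record 'v full_va =
  carr :: "'v set"
  scal :: "complex \<Rightarrow> 'v \<Rightarrow> 'v"
  grade :: "real \<Rightarrow> real \<Rightarrow> 'v set"
  Ycoeff :: "'v \<Rightarrow> real \<Rightarrow> real \<Rightarrow> 'v \<Rightarrow> 'v"
  vacuum :: 'v

definition mode :: "('v, 'z) full_va_scheme \<Rightarrow> 'v \<Rightarrow> real \<Rightarrow> real \<Rightarrow> 'v \<Rightarrow> 'v" where
  "mode V a r s b = Ycoeff V a (- r - 1) (- s - 1) b"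

definition graded_space :: "('v::ab_group_add, 'z) full_va_scheme \<Rightarrow> bool" where
  "graded_space V \<longleftrightarrow>
     vector_space (scal V) \<and>
     module.subspace (scal V) (carr V) \<and>
     (\<forall>h k. module.subspace (scal V) (grade V h k)) \<and>
     carr V = module.span (scal V) (\<Union>h k. grade V h k) \<and>
     (\<forall>v :: real \<times> real \<Rightarrow> 'v.
        (\<forall>h k. v (h, k) \<in> grade V h k) \<and> finite {i. v i \<noteq> 0} \<and> Sum_any v = 0
        \<longrightarrow> (\<forall>i. v i = 0))"

definition graded_dual :: "('v::ab_group_add, 'z) full_va_scheme \<Rightarrow> ('v \<Rightarrow> complex) set" where
  "graded_dual V = {u.
     (\<forall>x\<in>carr V. \<forall>y\<in>carr V. u (x + y) = u x + u y) \<and>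
     (\<forall>c. \<forall>x\<in>carr V. u (scal V c x) = c * u x) \<and>
     finite {(h, k). \<exists>x\<in>grade V h k. u x \<noteq> 0}}"

definition full_vertex_algebra :: "('v::ab_group_add, 'z) full_va_scheme \<Rightarrow> bool" where
  "full_vertex_algebra V \<longleftrightarrow>
     graded_space V \<and>
     vacuum V \<in> grade V 0 0 \<and>
     \<comment> \<open>\<open>Y\<close> is a linear map \<open>F \<rightarrow> End(F)[[z, zbar, |z|\<^sup>R]]\<close>\<close>
     (\<forall>a\<in>carr V. \<forall>b\<in>carr V. \<forall>s t. Ycoeff V a s t b \<in> carr V) \<and>
     (\<forall>a\<in>carr V. \<forall>b\<in>carr V. \<forall>b'\<in>carr V. \<forall>s t.
        Ycoeff V a s t (b + b') = Ycoeff V a s t b + Ycoeff V a s t b' \<and>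
        Ycoeff V (b + b') s t a = Ycoeff V b s t a + Ycoeff V b' s t a) \<and>
     (\<forall>a\<in>carr V. \<forall>b\<in>carr V. \<forall>c s t.
        Ycoeff V a s t (scal V c b) = scal V c (Ycoeff V a s t b) \<and>
        Ycoeff V (scal V c a) s t b = scal V c (Ycoeff V a s t b)) \<and>
     (\<forall>a\<in>carr V. \<forall>b\<in>carr V. \<forall>s t. s - t \<notin> \<int> \<longrightarrow> Ycoeff V a s t b = 0) \<and>
     (\<forall>a\<in>carr V. \<forall>b\<in>carr V. conf_series (\<lambda>s t. Ycoeff V a s t b)) \<and>
     (\<forall>h k. h - k \<notin> \<int> \<longrightarrow> grade V h k = {0}) \<and>
     (\<forall>a\<in>carr V. (\<forall>s t. Ycoeff V a s t (vacuum V) \<noteq> 0 \<longrightarrow> s \<in> \<nat> \<and> t \<in> \<nat>) \<and>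
        mode V a (- 1) (- 1) (vacuum V) = a) \<and>
     (\<forall>b\<in>carr V. \<forall>s t. Ycoeff V (vacuum V) s t b = (if s = 0 \<and> t = 0 then b else 0)) \<and>
     (\<forall>a\<in>carr V. \<forall>b\<in>carr V. \<forall>c\<in>carr V. \<forall>u\<in>graded_dual V. \<exists>\<mu>\<in>GCor2.
        expands_12 \<mu> (\<lambda>s t s' t'. u (Ycoeff V a s t (Ycoeff V b s' t' c))) \<and>
        expands_20 \<mu> (\<lambda>s t s' t'. u (Ycoeff V (Ycoeff V a s t b) s' t' c)) \<and>
        expands_21 \<mu> (\<lambda>s t s' t'. u (Ycoeff V b s' t' (Ycoeff V a s t c)))) \<and>
     (\<forall>h k h' k' r s. \<forall>a\<in>grade V h k. \<forall>b\<in>grade V h' k'.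
        mode V a r s b \<in> grade V (h + h' - r - 1) (k + k' - s - 1))"

definition D_op :: "('v, 'z) full_va_scheme \<Rightarrow> 'v \<Rightarrow> 'v" where
  "D_op V a = mode V a (- 2) (- 1) (vacuum V)"

definition Dbar_op :: "('v, 'z) full_va_scheme \<Rightarrow> 'v \<Rightarrow> 'v" where
  "Dbar_op V a = mode V a (- 1) (- 2) (vacuum V)"

definition bounded_below_va :: "('v::ab_group_add, 'z) full_va_scheme \<Rightarrow> bool" where
  "bounded_below_va V \<longleftrightarrow> (\<exists>N. \<forall>h k. h \<le> N \<or> k \<le> N \<longrightarrow> grade V h k = {0})"

text \<open>The library's \<open>dim\<close> is a natural number, so infinite dimension is made explicit.\<close>

definition edim :: "(complex \<Rightarrow> 'v \<Rightarrow> 'v) \<Rightarrow> 'v::ab_group_add set \<Rightarrow> ennreal" where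
  "edim sc S = (if \<exists>B. finite B \<and> S \<subseteq> module.span sc B then of_nat (vector_space.dim sc S) else \<infinity>)"

definition discrete_va :: "('v::ab_group_add, 'z) full_va_scheme \<Rightarrow> bool" where
  "discrete_va V \<longleftrightarrow>
     (\<forall>K. (\<Sum>\<^sub>\<infinity>(h, k) \<in> {(h, k). h + k < K}. edim (scal V) (grade V h k)) < \<infinity>)"

definition compact_va :: "('v::ab_group_add, 'z) full_va_scheme \<Rightarrow> bool" where
  "compact_va V \<longleftrightarrow> bounded_below_va V \<and> discrete_va V"

section \<open>Full H-vertex algebras\<close>

text \<open>
  The real vector space \<open>H\<close> is the whole type \<open>'h\<close>, \<open>proj\<close> is the projection onto \<open>H\<^sub>l\<close> along
  \<open>H\<^sub>r\<close>, and \<open>emb\<close> is the inclusion of \<open>H\<close> into \<open>F\<close>. The forms \<open>form_l\<close>, \<open>form_r\<close> are only used on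
  \<open>H\<^sub>l\<close>, \<open>H\<^sub>r\<close> respectively.
\<close>

record ('v, 'h) full_H_va = "'v full_va" +
  proj :: "'h \<Rightarrow> 'h"
  form_l :: "'h \<Rightarrow> 'h \<Rightarrow> real"
  form_r :: "'h \<Rightarrow> 'h \<Rightarrow> real"
  emb :: "'h \<Rightarrow> 'v"

definition co :: "('h \<Rightarrow> 'h) \<Rightarrow> 'h::real_vector \<Rightarrow> 'h" where
  "co p h = h - p h"

definition Hl :: "('v, 'h::real_vector) full_H_va \<Rightarrow> 'h set" where
  "Hl V = range (proj V)"

definition Hr :: "('v, 'h::real_vector) full_H_va \<Rightarrow> 'h set" where
  "Hr V = range (co (proj V))"

definition nondeg_sym_form :: "'h::real_vector set \<Rightarrow> ('h \<Rightarrow> 'h \<Rightarrow> real) \<Rightarrow> bool" where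
  "nondeg_sym_form S b \<longleftrightarrow>
     (\<forall>x\<in>S. \<forall>y\<in>S. b x y = b y x) \<and>
     (\<forall>x\<in>S. \<forall>y\<in>S. \<forall>z\<in>S. b (x + y) z = b x z + b y z) \<and>
     (\<forall>c. \<forall>x\<in>S. \<forall>y\<in>S. b (c *\<^sub>R x) y = c * b x y) \<and>
     (\<forall>x\<in>S. (\<forall>y\<in>S. b x y = 0) \<longrightarrow> x = 0)"

text \<open>\<open>h(n)\<close> for \<open>h\<close> in \<open>H\<close>, the linear extension of \<open>h\<^sub>l(n) = h\<^sub>l(n,-1)\<close> and \<open>h\<^sub>r(n) = h\<^sub>r(-1,n)\<close>.\<close>

definition heis_mode :: "('v::ab_group_add, 'h::real_vector) full_H_va \<Rightarrow> 'h \<Rightarrow> int \<Rightarrow> 'v \<Rightarrow> 'v" where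
  "heis_mode V h n v =
     mode V (emb V (proj V h)) (of_int n) (- 1) v +
     mode V (emb V (co (proj V) h)) (- 1) (of_int n) v"

definition weight_space :: "('v::ab_group_add, 'h::real_vector) full_H_va \<Rightarrow> 'h \<Rightarrow> 'v set" where
  "weight_space V \<alpha> = {v \<in> carr V.
     (\<forall>h\<in>Hl V. heis_mode V h 0 v = scal V (of_real (form_l V h (proj V \<alpha>))) v) \<and>
     (\<forall>h\<in>Hr V. heis_mode V h 0 v = scal V (of_real (form_r V h (co (proj V) \<alpha>))) v)}"

definition semisimple_real :: "('v::ab_group_add, 'z) full_va_scheme \<Rightarrow> ('v \<Rightarrow> 'v) \<Rightarrow> bool" where
  "semisimple_real V T \<longleftrightarrow>
     carr V = module.span (scal V) {v \<in> carr V. \<exists>r::real. T v = scal V (of_real r) v}"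

definition full_H_vertex_algebra :: "('v::ab_group_add, 'h::real_vector) full_H_va \<Rightarrow> bool" where
  "full_H_vertex_algebra V \<longleftrightarrow>
     full_vertex_algebra V \<and>
     (\<exists>B::'h set. finite B \<and> span B = UNIV) \<and>
     linear (proj V) \<and> (\<forall>h. proj V (proj V h) = proj V h) \<and>
     nondeg_sym_form (Hl V) (form_l V) \<and> nondeg_sym_form (Hr V) (form_r V) \<and>
     (\<forall>h h'. emb V (h + h') = emb V h + emb V h') \<and>
     (\<forall>c h. emb V (c *\<^sub>R h) = scal V (of_real c) (emb V h)) \<and>
     inj (emb V) \<and>
     (\<forall>h\<in>Hl V. emb V h \<in> grade V 1 0 \<and> Dbar_op V (emb V h) = 0) \<and>
     (\<forall>h\<in>Hr V. emb V h \<in> grade V 0 1 \<and> D_op V (emb V h) = 0) \<and>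
     (\<forall>h\<in>Hl V. \<forall>h'\<in>Hl V.
        mode V (emb V h) 1 (- 1) (emb V h') = scal V (of_real (form_l V h h')) (vacuum V) \<and>
        (\<forall>n::nat. n = 0 \<or> n \<ge> 2 \<longrightarrow> mode V (emb V h) (real n) (- 1) (emb V h') = 0)) \<and>
     (\<forall>h\<in>Hr V. \<forall>h'\<in>Hr V.
        mode V (emb V h) (- 1) 1 (emb V h') = scal V (of_real (form_r V h h')) (vacuum V) \<and>
        (\<forall>n::nat. n = 0 \<or> n \<ge> 2 \<longrightarrow> mode V (emb V h) (- 1) (real n) (emb V h') = 0)) \<and>
     (\<forall>h \<in> Hl V \<union> Hr V. semisimple_real V (heis_mode V h 0)) \<and>
     (\<forall>\<alpha>. \<exists>N. \<forall>t t'. t \<le> N \<or> t' \<le> N \<longrightarrow> grade V t t' \<inter> weight_space V \<alpha> = {0})"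

definition positive_va :: "('v::ab_group_add, 'h::real_vector) full_H_va \<Rightarrow> bool" where
  "positive_va V \<longleftrightarrow>
     (\<forall>h\<in>Hl V. h \<noteq> 0 \<longrightarrow> form_l V h h > 0) \<and> (\<forall>h\<in>Hr V. h \<noteq> 0 \<longrightarrow> form_r V h h > 0)"

definition vac_space :: "('v::ab_group_add, 'h::real_vector) full_H_va \<Rightarrow> 'h \<Rightarrow> 'v set" where
  "vac_space V \<alpha> = {v \<in> weight_space V \<alpha>.
     \<forall>h \<in> Hl V \<union> Hr V. \<forall>n\<ge>1. heis_mode V h n v = 0}"

definition vac_space_graded ::
  "('v::ab_group_add, 'h::real_vector) full_H_va \<Rightarrow> 'h \<Rightarrow> real \<Rightarrow> real \<Rightarrow> 'v set" where
  "vac_space_graded V \<alpha> t t' =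
     grade V (t + form_l V (proj V \<alpha>) (proj V \<alpha>) / 2)
             (t' + form_r V (co (proj V) \<alpha>) (co (proj V) \<alpha>) / 2) \<inter> vac_space V \<alpha>"

definition lat_form :: "('v, 'h::real_vector) full_H_va \<Rightarrow> 'h \<Rightarrow> 'h \<Rightarrow> real" where
  "lat_form V \<alpha> \<beta> =
     form_l V (proj V \<alpha>) (proj V \<beta>) - form_r V (co (proj V) \<alpha>) (co (proj V) \<beta>)"

definition lat_orthogonal :: "('v, 'h::real_vector) full_H_va \<Rightarrow> ('h \<Rightarrow> 'h) \<Rightarrow> bool" where
  "lat_orthogonal V \<sigma> \<longleftrightarrow>
     linear \<sigma> \<and> bij \<sigma> \<and> (\<forall>\<alpha> \<beta>. lat_form V (\<sigma> \<alpha>) (\<sigma> \<beta>) = lat_form V \<alpha> \<beta>)"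

section \<open>Operator-valued formal series\<close>

text \<open>
  \<open>A s t v\<close> is the coefficient of \<open>z\<^sup>s zbar\<^sup>t\<close> of the series applied to \<open>v\<close>. Sums over exponents are
  \<open>Sum_any\<close>, i.e. over the (here always finite) set of nonvanishing terms.
\<close>

type_synonym 'v oseries = "real \<Rightarrow> real \<Rightarrow> 'v \<Rightarrow> 'v"

definition ser_mon :: "real \<Rightarrow> real \<Rightarrow> ('v \<Rightarrow> 'v) \<Rightarrow> 'v::ab_group_add oseries" where
  "ser_mon i k T = (\<lambda>s t v. if s = i \<and> t = k then T v else 0)"

definition ser_sum :: "(nat \<Rightarrow> 'v oseries) \<Rightarrow> 'v::ab_group_add oseries" where
  "ser_sum A = (\<lambda>s t v. Sum_any (\<lambda>n. A n s t v))"

definition ser_add :: "'v oseries \<Rightarrow> 'v oseries \<Rightarrow> 'v::ab_group_add oseries" where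
  "ser_add A B = (\<lambda>s t v. A s t v + B s t v)"

definition ser_comp :: "'v oseries \<Rightarrow> 'v oseries \<Rightarrow> 'v::ab_group_add oseries" where
  "ser_comp A B = (\<lambda>s t v. Sum_any (\<lambda>(s', t'). A (s - s') (t - t') (B s' t' v)))"

primrec ser_pow :: "'v oseries \<Rightarrow> nat \<Rightarrow> 'v::ab_group_add oseries" where
  "ser_pow A 0 = ser_mon 0 0 (\<lambda>v. v)"
| "ser_pow A (Suc k) = ser_comp A (ser_pow A k)"

definition ser_exp :: "(complex \<Rightarrow> 'v \<Rightarrow> 'v) \<Rightarrow> 'v oseries \<Rightarrow> 'v::ab_group_add oseries" where
  "ser_exp sc A = ser_sum (\<lambda>k s t v. sc (1 / fact k) (ser_pow A k s t v))"

text \<open>Interchanging the roles of \<open>z\<close> and \<open>zbar\<close>.\<close>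

definition ser_conj :: "'v oseries \<Rightarrow> 'v oseries" where
  "ser_conj A = (\<lambda>s t. A t s)"

text \<open>The divided derivative: \<open>\<partial>\<^sup>n/n!\<close> sends \<open>z\<^sup>s\<^sup>+\<^sup>n\<close> to \<open>(s+n choose n) z\<^sup>s\<close>.\<close>

definition ser_dz :: "(complex \<Rightarrow> 'v \<Rightarrow> 'v) \<Rightarrow> nat \<Rightarrow> 'v oseries \<Rightarrow> 'v oseries" where
  "ser_dz sc n A = (\<lambda>s t v. sc (of_real ((s + real n) gchoose n)) (A (s + real n) t v))"

text \<open>
  For a family of operators \<open>hop h n\<close>, written \<open>h(n)\<close>, and a projection \<open>p\<close>, the series
  \<open>E\<^sup>\<epsilon>(\<alpha>) = exp (-\<epsilon> \<Sum>\<^sub>n\<^sub>\<ge>\<^sub>1 ((p \<alpha>)(\<epsilon>n)/n z\<^sup>-\<^sup>\<epsilon>\<^sup>n + (pbar \<alpha>)(\<epsilon>n)/n zbar\<^sup>-\<^sup>\<epsilon>\<^sup>n))\<close> for \<open>\<epsilon> = 1, -1\<close>.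
\<close>

definition E_ser ::
  "(complex \<Rightarrow> 'v \<Rightarrow> 'v) \<Rightarrow> ('h \<Rightarrow> int \<Rightarrow> 'v \<Rightarrow> 'v) \<Rightarrow> ('h \<Rightarrow> 'h) \<Rightarrow> int \<Rightarrow> 'h::real_vector
    \<Rightarrow> 'v::ab_group_add oseries" where
  "E_ser sc hop p \<epsilon> \<alpha> = ser_exp sc (ser_sum (\<lambda>n. if n = 0 then (\<lambda>s t v. 0) else
     ser_add
       (ser_mon (- of_int \<epsilon> * real n) 0 (\<lambda>v. sc (- of_int \<epsilon> / of_nat n) (hop (p \<alpha>) (\<epsilon> * int n) v)))
       (ser_mon 0 (- of_int \<epsilon> * real n)
          (\<lambda>v. sc (- of_int \<epsilon> / of_nat n) (hop (co p \<alpha>) (\<epsilon> * int n) v)))))"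

text \<open>\<open>h\<^sup>+(z) = \<Sum>\<^sub>k\<^sub>\<ge>\<^sub>0 h(k) z\<^sup>-\<^sup>k\<^sup>-\<^sup>1\<close> and \<open>h\<^sup>-(z) = \<Sum>\<^sub>k\<^sub>\<ge>\<^sub>0 h(-k-1) z\<^sup>k\<close>.\<close>

definition cur_plus :: "('h \<Rightarrow> int \<Rightarrow> 'v \<Rightarrow> 'v) \<Rightarrow> 'h \<Rightarrow> 'v::ab_group_add oseries" where
  "cur_plus hop h = ser_sum (\<lambda>k. ser_mon (- real k - 1) 0 (hop h (int k)))"

definition cur_minus :: "('h \<Rightarrow> int \<Rightarrow> 'v \<Rightarrow> 'v) \<Rightarrow> 'h \<Rightarrow> 'v::ab_group_add oseries" where
  "cur_minus hop h = ser_sum (\<lambda>k. ser_mon (real k) 0 (hop h (- int k - 1)))"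

text \<open>
  The vertex operator \<open>Yhat(v)\<close> for \<open>v\<close> in the vacuum space of weight \<open>\<alpha>\<close>, acting on the vacuum space
  of weight \<open>\<beta>\<close>, where \<open>z\<^sup>(\<^sup>-\<^sup>p\<^sup>\<alpha>\<^sup>)\<^sup>(\<^sup>0\<^sup>)\<close> is \<open>z\<close> to the power \<open>-(p \<alpha>, p \<beta>)\<^sub>l\<close>, and likewise for \<open>zbar\<close>.
\<close>

definition Yhat_vac ::
  "('v::ab_group_add, 'h::real_vector) full_H_va \<Rightarrow> 'h \<Rightarrow> 'v \<Rightarrow> 'h \<Rightarrow> 'v oseries" where
  "Yhat_vac V \<alpha> v \<beta> =
     ser_comp (E_ser (scal V) (heis_mode V) (proj V) (- 1) (- \<alpha>))
       (ser_comp (Ycoeff V v)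
         (ser_comp (E_ser (scal V) (heis_mode V) (proj V) 1 (- \<alpha>))
           (ser_mon (- form_l V (proj V \<alpha>) (proj V \<beta>))
                    (- form_r V (co (proj V) \<alpha>) (co (proj V) \<beta>)) (\<lambda>w. w))))"

section \<open>The Fock space\<close>

text \<open>
  Fix a basis of \<open>H\<close>. The Fock module \<open>M(\<alpha>)\<close> has the basis of monomials
  \<open>b\<^sub>1(-n\<^sub>1) \<dots> b\<^sub>k(-n\<^sub>k) e\<^sub>\<alpha>\<close> with \<open>b\<^sub>i\<close> basis vectors and \<open>n\<^sub>i \<ge> 1\<close>. Such a monomial is encoded as the
  pair of \<open>\<alpha>\<close> and the multiset of the \<open>(b\<^sub>i, n\<^sub>i)\<close>, and a vector as a finitely supported family of
  coefficients. The underlying space does not depend on \<open>p\<close>; the Heisenberg action does.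
\<close>

type_synonym 'h fock_index = "'h \<times> ('h \<times> nat) multiset"
type_synonym 'h fock = "'h fock_index \<Rightarrow>\<^sub>0 complex"

definition H_basis :: "'h::real_vector set" where
  "H_basis = extend_basis {}"

definition H_coord :: "'h::real_vector \<Rightarrow> 'h \<Rightarrow> real" where
  "H_coord = representation H_basis"

definition pm_scale :: "(complex \<Rightarrow> 'v \<Rightarrow> 'v) \<Rightarrow> complex \<Rightarrow> ('k \<Rightarrow>\<^sub>0 'v) \<Rightarrow> ('k \<Rightarrow>\<^sub>0 'v::zero)" where
  "pm_scale sc c x = Poly_Mapping.map (sc c) x"

abbreviation fock_scale :: "complex \<Rightarrow> 'h fock \<Rightarrow> 'h fock" where
  "fock_scale \<equiv> pm_scale (*)"

definition fock_lin :: "('h fock_index \<Rightarrow> 'h fock) \<Rightarrow> 'h fock \<Rightarrow> 'h fock" where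
  "fock_lin \<phi> x = (\<Sum>i \<in> Poly_Mapping.keys x. fock_scale (Poly_Mapping.lookup x i) (\<phi> i))"

definition fock_e :: "'h \<Rightarrow> 'h fock" where
  "fock_e \<alpha> = Poly_Mapping.single (\<alpha>, {#}) 1"

text \<open>
  The operator \<open>h(n)\<close> for the form \<open>f = (-,-)\<^sub>p\<close>: \<open>h(-n)\<close> is multiplication by \<open>\<Sum>\<^sub>b h\<^sub>b b(-n)\<close>,
  \<open>h(0)\<close> acts on \<open>M(\<alpha>)\<close> by \<open>(h, \<alpha>)\<^sub>p\<close>, and \<open>h(n)\<close> is the derivation with
  \<open>b(-n) \<mapsto> n (h, b)\<^sub>p\<close> and \<open>b(-m) \<mapsto> 0\<close> for \<open>m \<noteq> n\<close>.
\<close>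

definition fock_heis :: "('h \<Rightarrow> 'h \<Rightarrow> real) \<Rightarrow> 'h::real_vector \<Rightarrow> int \<Rightarrow> 'h fock \<Rightarrow> 'h fock" where
  "fock_heis f h n = fock_lin (\<lambda>(\<alpha>, m).
     if n < 0 then
       (\<Sum>b\<in>H_basis. Poly_Mapping.single (\<alpha>, m + {#(b, nat (- n))#}) (of_real (H_coord h b)))
     else if n = 0 then Poly_Mapping.single (\<alpha>, m) (of_real (f h \<alpha>))
     else
       (\<Sum>b\<in>H_basis. Poly_Mapping.single (\<alpha>, m - {#(b, nat n)#})
          (of_nat (count m (b, nat n)) * of_int n * of_real (f h b))))"

fun fock_word :: "('h \<Rightarrow> 'h \<Rightarrow> real) \<Rightarrow> ('h::real_vector \<times> nat) list \<Rightarrow> 'h fock \<Rightarrow> 'h fock" where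
  "fock_word f [] x = x"
| "fock_word f ((h, n) # w) x = fock_heis f h (- int n) (fock_word f w x)"

definition fock_graded ::
  "('h \<Rightarrow> 'h) \<Rightarrow> ('h \<Rightarrow> 'h \<Rightarrow> real) \<Rightarrow> 'h::real_vector \<Rightarrow> real \<Rightarrow> real \<Rightarrow> 'h fock set" where
  "fock_graded p f \<alpha> t t' = module.span fock_scale
     {fock_word f hs (fock_word f gs (fock_e \<alpha>)) | hs gs.
        (\<forall>(h, i) \<in> set hs. co p h = 0 \<and> i \<ge> 1) \<and>
        (\<forall>(g, i) \<in> set gs. p g = 0 \<and> i \<ge> 1) \<and>
        t = f (p \<alpha>) (p \<alpha>) / 2 + real (\<Sum>(h, i)\<leftarrow>hs. i) \<and>
        t' = f (co p \<alpha>) (co p \<alpha>) / 2 + real (\<Sum>(g, i)\<leftarrow>gs. i)}"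

definition fock_l :: "'h::real_vector \<Rightarrow> 'h fock \<Rightarrow> 'h fock" where
  "fock_l \<alpha> = fock_lin (\<lambda>(\<beta>, m). Poly_Mapping.single (\<alpha> + \<beta>, m) 1)"

definition fock_zpow :: "('h \<Rightarrow> 'h) \<Rightarrow> ('h \<Rightarrow> 'h \<Rightarrow> real) \<Rightarrow> 'h::real_vector \<Rightarrow> 'h fock oseries" where
  "fock_zpow p f \<alpha> = (\<lambda>s t. fock_lin (\<lambda>(\<beta>, m).
     if s = f (p \<alpha>) (p \<beta>) \<and> t = f (co p \<alpha>) (co p \<beta>) then Poly_Mapping.single (\<beta>, m) 1 else 0))"

text \<open>
  The vertex operator of \<open>h\<^sub>1(-n\<^sub>1) \<dots> h\<^sub>k(-n\<^sub>k) e\<^sub>\<alpha>\<close>, given by the list of the \<open>(h\<^sub>i, n\<^sub>i)\<close>. For arbitrary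
  \<open>h\<close> the rules for \<open>ker pbar\<close> and \<open>ker p\<close> are applied to the two parts of \<open>h = p h + pbar h\<close>.
\<close>

definition cur_act ::
  "('h \<Rightarrow> 'h \<Rightarrow> real) \<Rightarrow> (('h fock) oseries \<Rightarrow> ('h fock) oseries) \<Rightarrow> 'h::real_vector \<Rightarrow> nat
    \<Rightarrow> 'h fock oseries \<Rightarrow> 'h fock oseries" where
  "cur_act f c h n A =
     ser_add (ser_comp (c (ser_dz fock_scale n (cur_minus (fock_heis f) h))) A)
             (ser_comp A (c (ser_dz fock_scale n (cur_plus (fock_heis f) h))))"

fun fock_Y ::
  "('h \<Rightarrow> 'h) \<Rightarrow> ('h \<Rightarrow> 'h \<Rightarrow> real) \<Rightarrow> 'h::real_vector \<Rightarrow> ('h \<times> nat) list \<Rightarrow> 'h fock oseries" where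
  "fock_Y p f \<alpha> [] =
     ser_comp (E_ser fock_scale (fock_heis f) p (- 1) \<alpha>)
       (ser_comp (E_ser fock_scale (fock_heis f) p 1 \<alpha>)
         (ser_comp (ser_mon 0 0 (fock_l \<alpha>)) (fock_zpow p f \<alpha>)))"
| "fock_Y p f \<alpha> ((h, n) # w) =
     ser_add (cur_act f (\<lambda>A. A) (p h) (n - 1) (fock_Y p f \<alpha> w))
             (cur_act f ser_conj (co p h) (n - 1) (fock_Y p f \<alpha> w))"

text \<open>The result is independent of the order in which the factors of a monomial are listed.\<close>

definition fock_Y_mon ::
  "('h \<Rightarrow> 'h) \<Rightarrow> ('h \<Rightarrow> 'h \<Rightarrow> real) \<Rightarrow> 'h::real_vector fock_index \<Rightarrow> 'h fock oseries" where
  "fock_Y_mon p f = (\<lambda>(\<alpha>, m). fock_Y p f \<alpha> (SOME w. mset w = m))"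

section \<open>The current-current deformation\<close>

definition deform_proj :: "('v, 'h::real_vector) full_H_va \<Rightarrow> ('h \<Rightarrow> 'h) \<Rightarrow> 'h \<Rightarrow> 'h" where
  "deform_proj V \<sigma> = \<sigma> \<circ> proj V \<circ> inv \<sigma>"

definition p_form ::
  "('v, 'h::real_vector) full_H_va \<Rightarrow> ('h \<Rightarrow> 'h) \<Rightarrow> 'h \<Rightarrow> 'h \<Rightarrow> real" where
  "p_form V p h h' = lat_form V (p h) (p h') - lat_form V (co p h) (co p h')"

text \<open>
  \<open>M(\<alpha>) \<otimes> \<Omega>\<^sup>\<alpha>\<close> is realised as the space of finitely supported families, indexed by the monomials of
  \<open>M(\<alpha>)\<close>, of vectors in \<open>\<Omega>\<^sup>\<alpha>\<close>; a pure tensor \<open>a \<otimes> b\<close> is the family of the \<open>a\<^sub>i b\<close>.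
\<close>

type_synonym ('v, 'h) deform_space = "'h fock_index \<Rightarrow>\<^sub>0 'v"

definition tensor ::
  "('v::ab_group_add, 'h) full_H_va \<Rightarrow> 'h fock \<Rightarrow> 'v \<Rightarrow> ('v, 'h) deform_space" where
  "tensor V a b = Poly_Mapping.map (\<lambda>c. scal V c b) a"

definition deform_carr :: "('v::ab_group_add, 'h::real_vector) full_H_va \<Rightarrow> ('v, 'h) deform_space set"
where
  "deform_carr V = {x. \<forall>(\<alpha>, m) \<in> Poly_Mapping.keys x.
     set_mset m \<subseteq> H_basis \<times> {1..} \<and> Poly_Mapping.lookup x (\<alpha>, m) \<in> vac_space V \<alpha>}"

definition deform_grade ::
  "('v::ab_group_add, 'h::real_vector) full_H_va \<Rightarrow> ('h \<Rightarrow> 'h) \<Rightarrow> real \<Rightarrow> real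
    \<Rightarrow> ('v, 'h) deform_space set" where
  "deform_grade V p h k = module.span (pm_scale (scal V))
     (\<Union>\<alpha> s t. {tensor V a b | a b.
        a \<in> fock_graded p (p_form V p) \<alpha> s t \<and> b \<in> vac_space_graded V \<alpha> (h - s) (k - t)})"

text \<open>
  The bilinear extension of \<open>Y(a \<otimes> b) (c \<otimes> d) = Yhat(a) c \<otimes> Yhat(b) d\<close>, where \<open>a\<close> and \<open>c\<close> run
  through the monomials.
\<close>

definition deform_Y ::
  "('v::ab_group_add, 'h::real_vector) full_H_va \<Rightarrow> ('h \<Rightarrow> 'h)
    \<Rightarrow> ('v, 'h) deform_space \<Rightarrow> ('v, 'h) deform_space oseries" where
  "deform_Y V p x = (\<lambda>s t y.
     (\<Sum>i \<in> Poly_Mapping.keys x. \<Sum>k \<in> Poly_Mapping.keys y. Sum_any (\<lambda>(s', t').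
        tensor V
          (fock_Y_mon p (p_form V p) i s' t' (Poly_Mapping.single k 1))
          (Yhat_vac V (fst i) (Poly_Mapping.lookup x i) (fst k) (s - s') (t - t')
            (Poly_Mapping.lookup y k)))))"

definition deform_with ::
  "('v::ab_group_add, 'h::real_vector) full_H_va \<Rightarrow> ('h \<Rightarrow> 'h)
    \<Rightarrow> (('v, 'h) deform_space, 'h) full_H_va" where
  "deform_with V p =
     \<lparr> carr = deform_carr V,
       scal = pm_scale (scal V),
       grade = deform_grade V p,
       Ycoeff = deform_Y V p,
       vacuum = tensor V (fock_e 0) (vacuum V),
       proj = p,
       form_l = p_form V p,
       form_r = p_form V p,
       emb = (\<lambda>h. tensor V (fock_heis (p_form V p) h (- 1) (fock_e 0)) (vacuum V)) \<rparr>"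

definition deform ::
  "('v::ab_group_add, 'h::real_vector) full_H_va \<Rightarrow> ('h \<Rightarrow> 'h)
    \<Rightarrow> (('v, 'h) deform_space, 'h) full_H_va" where
  "deform V \<sigma> = deform_with V (deform_proj V \<sigma>)"

end

theory Submission
  imports Defs
begin

text \<open>
  Positivity is formal: \<open>\<sigma>\<close> preserves the lattice form, so it carries the forms on \<open>H\<^sub>l\<close> and \<open>H\<^sub>r\<close>
  isometrically to those on \<open>ker pbar\<close> and \<open>ker p\<close> (\<open>deform_proj_norms\<close>).

  For compactness, consider a nonzero pure tensor of a Fock vector and a vacuum vector of charge
  \<open>\<alpha>\<close>. Its weight is the sum of the weight \<open>(t, t')\<close> of the vacuum vector, the pair
  \<open>((p \<alpha>, p \<alpha>)\<^sub>p / 2, (pbar \<alpha>, pbar \<alpha>)\<^sub>p / 2)\<close>, and a pair of oscillator levels. All three are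
  nonnegative: the first by the hypothesis on the vacuum space, the second by positivity. So all
  weights of the deformation are nonnegative.

  For discreteness let the total weight be less than \<open>K\<close>. Then \<open>t + t'\<close>, the oscillator levels and
  \<open>(\<alpha>, \<alpha>)\<^sub>p\<close> are bounded. The form \<open>(-,-)\<^sub>p\<close> is positive definite on the finite-dimensional space
  \<open>H\<close>, so the undeformed norm of \<open>\<alpha>\<close> is at most a constant times \<open>(\<alpha>, \<alpha>)\<^sub>p\<close>
  (\<open>form_le_pos_def_form\<close>). Hence the vacuum vector lies in one of the graded pieces of the
  original algebra whose total weight is below a bound depending on \<open>K\<close> only; there are finitely
  many nonzero ones, each of finite dimension. Vectors of different charge are joint eigenvectors
  for different eigenvalues, so each piece contains vectors of only finitely many charges
  (\<open>finite_weights\<close>). Since there are finitely many Fock monomials of each level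
  (\<open>finite_fock_monomials\<close>), finitely many weights occur, and all graded pieces of total weight
  below \<open>K\<close> lie in the span of a single finite set.
\<close>

section \<open>Discreteness as a finiteness condition\<close>

text \<open>
  The sum in the definition of discreteness runs over uncountably many pairs of real weights.
  Dimensions are integers, so a nonzero term is at least 1, and infinitely many such terms already
  force an infinite sum.
\<close>

lemma infsum_ennreal_finite_iff:
  fixes f :: "'a \<Rightarrow> ennreal"
  assumes "\<And>x. x \<in> A \<Longrightarrow> f x \<noteq> 0 \<Longrightarrow> f x \<ge> 1"
  shows "infsum f A < \<infinity> \<longleftrightarrow> finite {x \<in> A. f x \<noteq> 0} \<and> (\<forall>x\<in>A. f x < \<infinity>)"
proof -
  let ?S = "{x \<in> A. f x \<noteq> 0}"
  have eq: "infsum f A = infsum f ?S"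
    by (rule infsum_cong_neutral) auto
  show ?thesis
  proof (cases "finite ?S")
    case True
    then have "infsum f A = sum f ?S" using eq by simp
    moreover have "(\<forall>x\<in>A. f x < \<infinity>) \<longleftrightarrow> (\<forall>x\<in>?S. f x < \<infinity>)"
      by (auto simp: less_top)
    ultimately show ?thesis using True by (auto simp: less_top[symmetric])
  next
    case False
    then have "infsum f ?S = \<infinity>"
      using assms by (intro infsum_superconst_infinite_ennreal[of _ 1]) auto
    then show ?thesis using False eq by simp
  qed
qed

lemma edim_eq_0_iff:
  assumes "vector_space sc" "module.subspace sc S"
  shows "edim sc S = 0 \<longleftrightarrow> S = {0}"
proof -
  interpret vector_space sc by fact
  show ?thesis
  proof
    assume z: "edim sc S = 0"
    then obtain T where T: "finite T" "S \<subseteq> span T" and d: "dim S = 0"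
      by (auto simp: edim_def split: if_splits)
    obtain B where B: "B \<subseteq> S" "independent B" "S \<subseteq> span B" "card B = dim S"
      using basis_exists by blast
    have "finite B" using independent_span_bound[OF T(1) B(2)] B(1) T(2) by blast
    then have "B = {}" using B(4) d by simp
    then show "S = {0}" using B(3) subspace_0[OF assms(2)] by auto
  next
    assume S: "S = {0}"
    have "dim {0} = card {}" by (rule dim_unique) (auto simp: independent_empty)
    then show "edim sc S = 0"
      using S by (auto simp: edim_def intro!: exI[of _ "{}"])
  qed
qed

lemma edim_less_top_iff: "edim sc S < \<infinity> \<longleftrightarrow> (\<exists>B. finite B \<and> S \<subseteq> module.span sc B)"
  by (simp add: edim_def of_nat_less_top)

lemma edim_ge_1:
  assumes "edim sc S \<noteq> 0"
  shows "edim sc S \<ge> 1"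
proof (cases "edim sc S < \<infinity>")
  case True
  then have "\<exists>B. finite B \<and> S \<subseteq> module.span sc B" by (simp only: edim_less_top_iff)
  then have n: "edim sc S = of_nat (vector_space.dim sc S)" (is "_ = of_nat ?n")
    by (simp only: edim_def if_True)
  then have "1 \<le> ?n" using assms by (cases ?n) auto
  then show ?thesis using n by (metis of_nat_1 of_nat_le_iff)
next
  case False
  then have "edim sc S = top" by (simp add: less_top[symmetric])
  then show ?thesis by simp
qed

text \<open>
  The form in which discreteness is used for \<open>V\<close> and proved for its deformation: both
  conditions can be certified by exhibiting a finite superset or a finite spanning set, and no
  dimension has to be computed.
\<close>

lemma discrete_va_iff:
  assumes "vector_space (scal V)" "\<And>h k. module.subspace (scal V) (grade V h k)"
  shows "discrete_va V \<longleftrightarrow> (\<forall>K. finite {(h, k). h + k < K \<and> grade V h k \<noteq> {0}} \<and>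
    (\<forall>h k. h + k < K \<longrightarrow> (\<exists>B. finite B \<and> grade V h k \<subseteq> module.span (scal V) B)))"
proof -
  interpret vector_space "scal V" by fact
  have "(\<Sum>\<^sub>\<infinity>(h, k) \<in> {(h, k). h + k < K}. edim (scal V) (grade V h k)) < \<infinity> \<longleftrightarrow>
    finite {(h, k). h + k < K \<and> grade V h k \<noteq> {0}} \<and>
    (\<forall>h k. h + k < K \<longrightarrow> (\<exists>B. finite B \<and> grade V h k \<subseteq> module.span (scal V) B))" for K
  proof -
    let ?A = "{(h, k). h + k < K}" and ?f = "\<lambda>(h, k). edim (scal V) (grade V h k)"
    have "{x \<in> ?A. ?f x \<noteq> 0}
        = {(h, k). h + k < K \<and> grade V h k \<noteq> {0}}"
      using edim_eq_0_iff[OF assms] by (intro set_eqI) (simp split: prod.split)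
    moreover have "infsum ?f ?A < \<infinity> \<longleftrightarrow> finite {x \<in> ?A. ?f x \<noteq> 0} \<and> (\<forall>x\<in>?A. ?f x < \<infinity>)"
      by (rule infsum_ennreal_finite_iff) (simp add: edim_ge_1 split: prod.splits)
    moreover have "(\<forall>x\<in>?A. ?f x < \<infinity>) \<longleftrightarrow>
        (\<forall>h k. h + k < K \<longrightarrow> (\<exists>B. finite B \<and> grade V h k \<subseteq> module.span (scal V) B))"
      unfolding edim_less_top_iff[symmetric] by simp
    ultimately show ?thesis by (simp only:)
  qed
  then show ?thesis unfolding discrete_va_def by (simp only:)
qed

section \<open>Simultaneous eigenvectors\<close>

context vector_space
begin

text \<open>
  The argument for a single operator, with the operator chosen anew for each pair of indices:
  applying \<open>T x - ev j x\<close> to a relation removes its \<open>j\<close>-th term, and \<open>x\<close> can be chosen so that a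
  given other term survives. Here \<open>C\<close> stands for the carrier of a vertex algebra, on which its
  mode operators are linear.
\<close>

lemma joint_eigenvectors_sum_zero:
  assumes "finite A"
    and C: "subspace C"
    and add: "\<And>x v w. x \<in> X \<Longrightarrow> v \<in> C \<Longrightarrow> w \<in> C \<Longrightarrow> T x (v + w) = T x v + T x w"
    and scl: "\<And>x c v. x \<in> X \<Longrightarrow> v \<in> C \<Longrightarrow> T x (scale c v) = scale c (T x v)"
    and "\<And>i j. i \<in> A \<Longrightarrow> j \<in> A \<Longrightarrow> i \<noteq> j \<Longrightarrow> \<exists>x\<in>X. ev i x \<noteq> ev j x"
    and "\<And>i. i \<in> A \<Longrightarrow> v i \<in> C"
    and "\<And>i x. i \<in> A \<Longrightarrow> x \<in> X \<Longrightarrow> T x (v i) = scale (ev i x) (v i)"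
    and "(\<Sum>i\<in>A. v i) = 0"
  shows "\<forall>i\<in>A. v i = 0"
  using assms(1,5-)
proof (induction A arbitrary: v rule: finite_induct)
  case empty
  then show ?case by simp
next
  case (insert j A)
  have T_sum: "T x (sum v B) = (\<Sum>i\<in>B. T x (v i))"
    if x: "x \<in> X" and "finite B" "v ` B \<subseteq> C" for B x
    using that(2,3)
  proof (induction B rule: finite_induct)
    case empty
    show ?case using scl[OF x subspace_0[OF C], of 0] by simp
  next
    case (insert i B)
    have "sum v B \<in> C" using insert.prems by (intro subspace_sum[OF C]) auto
    then have "T x (v i + sum v B) = T x (v i) + T x (sum v B)"
      using insert.prems by (intro add[OF x]) auto
    then show ?case using insert.hyps insert.IH insert.prems by simp
  qed
  have *: "v i = 0" if i: "i \<in> A" for i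
  proof -
    have "i \<noteq> j" using i insert.hyps by auto
    then obtain x where x: "x \<in> X" "ev i x \<noteq> ev j x"
      using insert.prems(1)[of i j] i by auto
    (* These vectors are T x - ev j x applied to the v k; the one at j vanishes. *)
    define w where "w k = scale (ev k x - ev j x) (v k)" for k
    have "(\<Sum>k\<in>insert j A. w k) = (\<Sum>k\<in>insert j A. T x (v k)) - (\<Sum>k\<in>insert j A. scale (ev j x) (v k))"
      unfolding w_def sum_subtractf[symmetric]
      by (intro sum.cong refl) (simp add: scale_left_diff_distrib insert.prems(3) x(1))
    also have "(\<Sum>k\<in>insert j A. T x (v k)) = T x (\<Sum>k\<in>insert j A. v k)"
      using insert.hyps(1) insert.prems(2) by (intro T_sum[OF x(1), symmetric]) auto
    also have "\<dots> = 0"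
      using insert.prems(4) scl[OF x(1) subspace_0[OF C], of 0] by simp
    also have "(\<Sum>k\<in>insert j A. scale (ev j x) (v k)) = 0"
      using insert.prems(4) by (simp add: scale_sum_right[symmetric] del: sum.insert)
    finally have "(\<Sum>k\<in>A. w k) = 0"
      using insert.hyps by (simp add: w_def)
    moreover have "w k \<in> C" "\<And>y. y \<in> X \<Longrightarrow> T y (w k) = scale (ev k y) (w k)" if "k \<in> A" for k
      using that insert.prems(2,3) subspace_scale[OF C] scl
      by (auto simp: w_def mult.commute)
    ultimately have "\<forall>k\<in>A. w k = 0"
      using insert.prems(1) by (intro insert.IH) auto
    then have "w i = 0" using i by blast
    then show "v i = 0" using x(2) by (simp add: w_def)
  qed
  then have "v j = 0" using insert.prems(4) insert.hyps by simp
  then show ?case using * by auto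
qed

text \<open>
  Eigenvectors for pairwise distinct joint eigenvalues are independent, so there cannot be more of
  them than spanning vectors.
\<close>

lemma finite_joint_eigenvalues:
  assumes B: "finite B" "S \<subseteq> span B"
    and C: "subspace C"
    and add: "\<And>x v w. x \<in> X \<Longrightarrow> v \<in> C \<Longrightarrow> w \<in> C \<Longrightarrow> T x (v + w) = T x v + T x w"
    and scl: "\<And>x c v. x \<in> X \<Longrightarrow> v \<in> C \<Longrightarrow> T x (scale c v) = scale c (T x v)"
    and sep: "\<And>i j. i \<in> A \<Longrightarrow> j \<in> A \<Longrightarrow> i \<noteq> j \<Longrightarrow> \<exists>x\<in>X. ev i x \<noteq> ev j x"
    and ex: "\<And>i. i \<in> A \<Longrightarrow> \<exists>v\<in>S \<inter> C. v \<noteq> 0 \<and> (\<forall>x\<in>X. T x v = scale (ev i x) v)"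
  shows "finite A"
proof (rule ccontr)
  assume "infinite A"
  then obtain A' where A': "A' \<subseteq> A" "finite A'" "card A' = Suc (card B)"
    using infinite_arbitrarily_large by blast
  obtain v where v: "\<And>i. i \<in> A \<Longrightarrow> v i \<in> S" "\<And>i. i \<in> A \<Longrightarrow> v i \<in> C" "\<And>i. i \<in> A \<Longrightarrow> v i \<noteq> 0"
    "\<And>i x. i \<in> A \<Longrightarrow> x \<in> X \<Longrightarrow> T x (v i) = scale (ev i x) (v i)"
  proof -
    have "\<forall>i\<in>A. \<exists>v. v \<in> S \<inter> C \<and> v \<noteq> 0 \<and> (\<forall>x\<in>X. T x v = scale (ev i x) v)"
      using ex by blast
    from bchoice[OF this] show ?thesis using that by blast
  qed
  have inj: "inj_on v A'"
  proof (rule inj_onI, rule ccontr)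
    fix i j assume ij: "i \<in> A'" "j \<in> A'" "v i = v j" "i \<noteq> j"
    then obtain x where "x \<in> X" "ev i x \<noteq> ev j x" using sep A'(1) by blast
    moreover have "i \<in> A" "j \<in> A" using ij A'(1) by auto
    ultimately have "scale (ev i x) (v i) = scale (ev j x) (v i)"
      using v(4)[of i x] v(4)[of j x] ij(3) by simp
    then show False using v(3)[OF \<open>i \<in> A\<close>] \<open>ev i x \<noteq> ev j x\<close> by simp
  qed
  have "independent (v ` A')"
  proof (rule independent_if_scalars_zero)
    fix f x assume "(\<Sum>y\<in>v ` A'. scale (f y) y) = 0" and x: "x \<in> v ` A'"
    then have s0: "(\<Sum>i\<in>A'. scale (f (v i)) (v i)) = 0" by (simp add: sum.reindex[OF inj])
    have "\<forall>i\<in>A'. scale (f (v i)) (v i) = 0"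
    proof (rule joint_eigenvectors_sum_zero[where X = X and T = T and ev = ev, OF A'(2) C])
      show "T x (scale (f (v i)) (v i)) = scale (ev i x) (scale (f (v i)) (v i))"
        if "i \<in> A'" "x \<in> X" for i x
        using that A'(1) scl[of x "v i"] v(2,4) by (simp add: subset_iff mult.commute)
      show "scale (f (v i)) (v i) \<in> C" if "i \<in> A'" for i
        using that A'(1) v(2) by (intro subspace_scale[OF C]) auto
      show "\<exists>x\<in>X. ev i x \<noteq> ev j x" if "i \<in> A'" "j \<in> A'" "i \<noteq> j" for i j
        using that A'(1) sep by blast
    qed (fact add scl s0)+
    then show "f x = 0" using x v(3) A'(1) by auto
  qed (use A' in simp)
  then have "card (v ` A') \<le> card B"
    using independent_span_bound[OF B(1)] v(1) B(2) A'(1) by blast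
  then show False using A'(3) by (simp add: card_image[OF inj])
qed

end

section \<open>Comparison of quadratic forms\<close>

text \<open>
  Gram-Schmidt on a bare vector space, where the form is the only source of geometry.
\<close>

lemma orthonormal_spanning_set:
  fixes b :: "'h::real_vector \<Rightarrow> 'h \<Rightarrow> real"
  assumes bil: "bilinear b" and sym: "\<And>x y. b x y = b y x"
    and pos: "\<And>x. x \<noteq> 0 \<Longrightarrow> b x x > 0" and "finite B"
  shows "\<exists>E. finite E \<and> span E = span B \<and> (\<forall>e\<in>E. \<forall>e'\<in>E. b e e' = (if e = e' then 1 else 0))"
  using \<open>finite B\<close>
proof (induction B rule: finite_induct)
  case empty
  show ?case by (intro exI[of _ "{}"]) auto
next
  case (insert v B)
  then obtain E where E: "finite E" "span E = span B"
    "\<And>e e'. e \<in> E \<Longrightarrow> e' \<in> E \<Longrightarrow> b e e' = (if e = e' then 1 else 0)" by blast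
  (* The orthogonal projection of v to the span of E. *)
  define w where "w = (\<Sum>e\<in>E. b v e *\<^sub>R e)"
  have w: "w \<in> span E" unfolding w_def by (intro span_sum span_scale span_base)
  have orth: "b (v - w) e = 0" if "e \<in> E" for e
  proof -
    have "linear (\<lambda>x. b x e)" using bil by (simp add: bilinear_def)
    then have "b w e = (\<Sum>e'\<in>E. b v e' * b e' e)"
      unfolding w_def by (simp add: linear_sum[where f = "\<lambda>x. b x e"] linear_cmul[where f = "\<lambda>x. b x e"])
    also have "\<dots> = (\<Sum>e'\<in>E. if e' = e then b v e else 0)"
      using that E(3) by (intro sum.cong) auto
    also have "\<dots> = b v e" using that E(1) by simp
    finally show ?thesis using bil by (simp add: bilinear_lsub)
  qed
  show ?case
  proof (cases "v = w")
    case True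
    then have "span (insert v B) = span E" using w E(2) by (metis span_redundant)
    then show ?thesis using E by blast
  next
    case False
    define r where "r = sqrt (b (v - w) (v - w))"
    have r: "r > 0" "r * r = b (v - w) (v - w)" using pos[of "v - w"] False by (auto simp: r_def)
    define u where "u = (1 / r) *\<^sub>R (v - w)"
    have "b u u = (1 / r) * ((1 / r) * b (v - w) (v - w))"
      unfolding u_def bilinear_lmul[OF bil] bilinear_rmul[OF bil] by simp
    also have "\<dots> = 1" using r(1) unfolding r(2)[symmetric] by (simp add: field_simps)
    finally have uu: "b u u = 1" .
    have ue: "b u e = 0" if "e \<in> E" for e
      unfolding u_def bilinear_lmul[OF bil] orth[OF that] by simp
    have "span (insert u E) = span (insert v E)"
      unfolding span_eq
    proof safe
      have w': "w \<in> span (insert y E)" for y using w span_mono[of E "insert y E"] by auto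
      show "u \<in> span (insert v E)" unfolding u_def
        by (intro span_scale span_diff w' span_base) simp
      have "r *\<^sub>R u + w \<in> span (insert u E)"
        by (intro span_add span_scale w' span_base) simp
      also have "r *\<^sub>R u + w = v" using r by (simp add: u_def)
      finally show "v \<in> span (insert u E)" .
    qed (auto intro: span_base)
    also have "\<dots> = span (insert v B)" using E(2) by (simp add: span_insert)
    finally have "span (insert u E) = span (insert v B)" .
    moreover have "\<forall>e\<in>insert u E. \<forall>e'\<in>insert u E. b e e' = (if e = e' then 1 else 0)"
      using uu ue E(3) sym by (metis insert_iff zero_neq_one)
    ultimately show ?thesis using E(1) by (intro exI[of _ "insert u E"]) auto
  qed
qed

text \<open>
  A substitute for compactness of the unit sphere: in coordinates orthonormal for \<open>b'\<close>, every
  product of two coordinates is bounded by \<open>b' x x\<close>, so the sum of the absolute values of the matrix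
  entries of \<open>b\<close> serves as the constant.
\<close>

lemma form_le_pos_def_form:
  fixes b b' :: "'h::real_vector \<Rightarrow> 'h \<Rightarrow> real"
  assumes "\<exists>B::'h set. finite B \<and> span B = UNIV"
    and bil: "bilinear b" "bilinear b'" and sym: "\<And>x y. b' x y = b' y x"
    and pos: "\<And>x. x \<noteq> 0 \<Longrightarrow> b' x x > 0"
  shows "\<exists>C\<ge>0. \<forall>x. b x x \<le> C * b' x x"
proof -
  obtain B :: "'h set" where "finite B" "span B = UNIV" using assms(1) by blast
  then obtain E where E: "finite E" "span E = UNIV"
    "\<And>e e'. e \<in> E \<Longrightarrow> e' \<in> E \<Longrightarrow> b' e e' = (if e = e' then 1 else 0)"
    using orthonormal_spanning_set[OF bil(2) sym pos \<open>finite B\<close>] by metis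
  define C where "C = (\<Sum>e\<in>E. \<Sum>e'\<in>E. \<bar>b e e'\<bar>)"
  have "b x x \<le> C * b' x x" for x
  proof -
    have "x \<in> span E" using E by simp
    then obtain c where x: "x = (\<Sum>e\<in>E. c e *\<^sub>R e)" using span_finite[OF E(1)] by auto
    have expand: "q x x = (\<Sum>e\<in>E. \<Sum>e'\<in>E. c e * c e' * q e e')" if "bilinear q" for q :: "'h \<Rightarrow> 'h \<Rightarrow> real"
      unfolding x using that
      by (simp add: bilinear_sum[OF that] bilinear_lmul bilinear_rmul sum.cartesian_product mult_ac)
    have "b' x x = (\<Sum>e\<in>E. \<Sum>e'\<in>E. if e' = e then c e * c e else 0)"
      unfolding expand[OF bil(2)] using E(3) by (intro sum.cong refl) auto
    also have "\<dots> = (\<Sum>e\<in>E. (c e)\<^sup>2)" using E(1) by (simp add: power2_eq_square)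
    finally have n: "b' x x = (\<Sum>e\<in>E. (c e)\<^sup>2)" .
    have "c e * c e' * b e e' \<le> \<bar>b e e'\<bar> * b' x x" if "e \<in> E" "e' \<in> E" for e e'
    proof -
      have "(c e)\<^sup>2 \<le> b' x x" "(c e')\<^sup>2 \<le> b' x x"
        unfolding n using that E(1) by (auto intro: member_le_sum)
      moreover have "2 * \<bar>c e * c e'\<bar> \<le> (c e)\<^sup>2 + (c e')\<^sup>2"
        using sum_squares_bound[of "\<bar>c e\<bar>" "\<bar>c e'\<bar>"] by (simp add: abs_mult)
      ultimately have le: "\<bar>c e * c e'\<bar> \<le> b' x x" by linarith
      have "c e * c e' * b e e' \<le> \<bar>c e * c e'\<bar> * \<bar>b e e'\<bar>" by (metis abs_ge_self abs_mult)
      also have "\<dots> \<le> \<bar>b e e'\<bar> * b' x x" using mult_right_mono[OF le, of "\<bar>b e e'\<bar>"] by (simp add: mult.commute)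
      finally show ?thesis .
    qed
    then show ?thesis unfolding expand[OF bil(1)] C_def sum_distrib_right by (intro sum_mono) auto
  qed
  moreover have "C \<ge> 0" unfolding C_def by (intro sum_nonneg) auto
  ultimately show ?thesis by blast
qed

section \<open>Finitely supported families as tensor products\<close>

lemma lookup_pm_scale:
  assumes "vector_space sc"
  shows "Poly_Mapping.lookup (pm_scale sc c x) i = sc c (Poly_Mapping.lookup x i)"
proof -
  interpret vector_space sc by fact
  show ?thesis by (simp add: pm_scale_def Poly_Mapping.map.rep_eq when_def)
qed

lemma vector_space_pm_scale:
  assumes "vector_space sc"
  shows "vector_space (pm_scale sc :: _ \<Rightarrow> ('k \<Rightarrow>\<^sub>0 'v::ab_group_add) \<Rightarrow> _)"
proof -
  interpret vector_space sc by fact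
  show ?thesis
    by unfold_locales
      (auto intro!: poly_mapping_eqI
        simp: lookup_pm_scale[OF assms] lookup_add scale_right_distrib scale_left_distrib)
qed

lemma keys_map_subset: "Poly_Mapping.keys (Poly_Mapping.map f x) \<subseteq> Poly_Mapping.keys x"
  by (auto simp: in_keys_iff Poly_Mapping.map.rep_eq when_def)

lemma subspace_keys_subset:
  assumes "vector_space sc"
  shows "module.subspace (pm_scale sc) {x :: 'k \<Rightarrow>\<^sub>0 'v::ab_group_add. Poly_Mapping.keys x \<subseteq> K}"
proof -
  interpret vector_space "pm_scale sc :: _ \<Rightarrow> ('k \<Rightarrow>\<^sub>0 'v) \<Rightarrow> _"
    by (rule vector_space_pm_scale) fact
  show ?thesis
  proof (rule subspaceI)
    fix c and x y :: "'k \<Rightarrow>\<^sub>0 'v" assume x: "x \<in> {x. Poly_Mapping.keys x \<subseteq> K}" and y: "y \<in> {x. Poly_Mapping.keys x \<subseteq> K}"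
    show "x + y \<in> {x. Poly_Mapping.keys x \<subseteq> K}"
      using x y keys_add[of x y] by blast
    show "pm_scale sc c x \<in> {x. Poly_Mapping.keys x \<subseteq> K}"
      using x keys_map_subset[of "sc c" x] by (simp add: pm_scale_def)
  qed simp
qed

text \<open>
  Families with support in \<open>X\<close> and values in \<open>span B\<close> form the tensor product of the free space on
  \<open>X\<close> with \<open>span B\<close>; for finite \<open>X\<close> and \<open>B\<close> this gives a finite spanning set.
\<close>

lemma pm_in_span_single:
  assumes "vector_space sc"
    and "Poly_Mapping.keys x \<subseteq> X" "\<And>k. Poly_Mapping.lookup x k \<in> module.span sc B"
  shows "x \<in> module.span (pm_scale sc) ((\<lambda>(k, b). Poly_Mapping.single k b) ` (X \<times> B))"
    (is "_ \<in> module.span _ ?G")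
proof -
  interpret V: vector_space sc by fact
  interpret P: vector_space "pm_scale sc :: _ \<Rightarrow> ('b \<Rightarrow>\<^sub>0 'a) \<Rightarrow> _"
    by (rule vector_space_pm_scale) fact
  have single: "Poly_Mapping.single k v \<in> P.span ?G" if "k \<in> X" "v \<in> V.span B" for k v
  proof -
    have "V.subspace {v. Poly_Mapping.single k v \<in> P.span ?G}"
    proof (rule V.subspaceI)
      show "0 \<in> {v. Poly_Mapping.single k v \<in> P.span ?G}" using P.span_zero by simp
      show "v + w \<in> {v. Poly_Mapping.single k v \<in> P.span ?G}"
        if "v \<in> {v. Poly_Mapping.single k v \<in> P.span ?G}" "w \<in> {v. Poly_Mapping.single k v \<in> P.span ?G}" for v w
        using that P.span_add by (simp add: single_add)
      show "sc c v \<in> {v. Poly_Mapping.single k v \<in> P.span ?G}"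
        if "v \<in> {v. Poly_Mapping.single k v \<in> P.span ?G}" for c v
      proof -
        have "Poly_Mapping.single k (sc c v) = pm_scale sc c (Poly_Mapping.single k v)"
          by (rule poly_mapping_eqI) (simp add: lookup_pm_scale[OF assms(1)] lookup_single when_def)
        then show ?thesis using that P.span_scale by simp
      qed
    qed
    then have "V.span B \<subseteq> {v. Poly_Mapping.single k v \<in> P.span ?G}"
      using that(1) by (intro V.span_minimal) (auto intro!: P.span_base)
    then show ?thesis using that(2) by blast
  qed
  have "x = (\<Sum>k\<in>Poly_Mapping.keys x. Poly_Mapping.single k (Poly_Mapping.lookup x k))"
    by (rule poly_mapping_eqI) (simp add: lookup_sum lookup_single when_def in_keys_iff)
  also have "\<dots> \<in> P.span ?G" using assms(2,3) by (intro P.span_sum single) auto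
  finally show ?thesis .
qed

section \<open>Graded pieces of the Fock space\<close>

definition fock_monomials :: "nat \<Rightarrow> ('h::real_vector \<times> nat) multiset set" where
  "fock_monomials N = {m. set_mset m \<subseteq> H_basis \<times> {1..} \<and> (\<Sum>x\<in>#m. snd x) = N}"

lemma finite_H_basis:
  assumes "\<exists>B::'h::real_vector set. finite B \<and> span B = UNIV"
  shows "finite (H_basis :: 'h set)"
proof -
  obtain B :: "'h set" where "finite B" "span B = UNIV" using assms by blast
  then show ?thesis
    using independent_span_bound[of B "H_basis :: 'h set"] independent_extend_basis[of "{} :: 'h set"]
    by (simp add: H_basis_def independent_empty)
qed

text \<open>
  Every factor \<open>(b, n)\<close> contributes \<open>n \<ge> 1\<close> to the level, so a monomial of level \<open>N\<close> has at most
  \<open>N\<close> factors, each with mode at most \<open>N\<close>.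
\<close>

lemma finite_fock_monomials:
  assumes "finite (H_basis :: 'h::real_vector set)"
  shows "finite (fock_monomials N :: ('h \<times> nat) multiset set)"
proof -
  have "fock_monomials N \<subseteq> (\<Union>k\<le>N. multisets_of_size ((H_basis :: 'h set) \<times> {1..N}) k)"
  proof
    fix m :: "('h \<times> nat) multiset" assume m: "m \<in> fock_monomials N"
    have size: "size m \<le> (\<Sum>x\<in>#m. snd x)" if "\<forall>x\<in>#m. snd x \<ge> 1" using that
      by (induction m) auto
    have snd: "snd x \<le> (\<Sum>x\<in>#m. snd x)" if "x \<in># m" for x
      using multi_member_split[OF that] by auto
    have "\<forall>x\<in>#m. snd x \<ge> 1" "set_mset m \<subseteq> H_basis \<times> {1..}" "(\<Sum>x\<in>#m. snd x) = N"
      using m by (auto simp: fock_monomials_def)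
    then have "size m \<le> N" "set_mset m \<subseteq> H_basis \<times> {1..N}"
      using size snd by auto
    then show "m \<in> (\<Union>k\<le>N. multisets_of_size ((H_basis :: 'h set) \<times> {1..N}) k)"
      by (simp add: multisets_of_size_def)
  qed
  then show ?thesis by (rule finite_subset) (use assms in auto)
qed

text \<open>
  The images of Fock vectors are followed through their supports rather than through spans: a
  bound on supports passes through the sum that defines \<open>fock_lin\<close> term by term.
\<close>

lemma keys_fock_lin:
  assumes "\<And>i. i \<in> Poly_Mapping.keys x \<Longrightarrow> Poly_Mapping.keys (\<phi> i) \<subseteq> K"
  shows "Poly_Mapping.keys (fock_lin \<phi> x) \<subseteq> K"
proof -
  have "Poly_Mapping.keys (fock_lin \<phi> x) \<subseteq>
      (\<Union>i\<in>Poly_Mapping.keys x. Poly_Mapping.keys (fock_scale (Poly_Mapping.lookup x i) (\<phi> i)))"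
    unfolding fock_lin_def by (rule keys_sum)
  also have "\<dots> \<subseteq> (\<Union>i\<in>Poly_Mapping.keys x. Poly_Mapping.keys (\<phi> i))"
    unfolding pm_scale_def by (intro UN_mono order_refl keys_map_subset)
  also have "\<dots> \<subseteq> K" using assms by blast
  finally show ?thesis .
qed

lemma keys_fock_heis_creation:
  assumes x: "Poly_Mapping.keys x \<subseteq> {\<alpha>} \<times> fock_monomials N" and "i \<ge> 1"
  shows "Poly_Mapping.keys (fock_heis f h (- int i) x) \<subseteq> {\<alpha>} \<times> fock_monomials (i + N)"
  unfolding fock_heis_def
proof (rule keys_fock_lin)
  let ?s = "\<lambda>m b. Poly_Mapping.single (\<alpha>, m + {#(b, i)#}) (complex_of_real (H_coord h b))"
  fix j assume "j \<in> Poly_Mapping.keys x"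
  then obtain m where j: "j = (\<alpha>, m)" and m: "m \<in> fock_monomials N" using x by auto
  have "Poly_Mapping.keys (\<Sum>b\<in>H_basis. ?s m b) \<subseteq> (\<Union>b\<in>H_basis. Poly_Mapping.keys (?s m b))"
    by (rule keys_sum)
  also have "\<dots> \<subseteq> {\<alpha>} \<times> fock_monomials (i + N)"
    using m \<open>i \<ge> 1\<close> by (intro UN_least) (simp add: fock_monomials_def)
  finally have sub: "Poly_Mapping.keys (\<Sum>b\<in>H_basis. ?s m b) \<subseteq> {\<alpha>} \<times> fock_monomials (i + N)" .
  show "Poly_Mapping.keys (case j of (\<alpha>, m) \<Rightarrow>
     if - int i < 0 then
       (\<Sum>b\<in>H_basis. Poly_Mapping.single (\<alpha>, m + {#(b, nat (- (- int i)))#}) (complex_of_real (H_coord h b)))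
     else if - int i = 0 then Poly_Mapping.single (\<alpha>, m) (complex_of_real (f h \<alpha>))
     else
       (\<Sum>b\<in>H_basis. Poly_Mapping.single (\<alpha>, m - {#(b, nat (- int i))#})
          (of_nat (count m (b, nat (- int i))) * of_int (- int i) * complex_of_real (f h b))))
    \<subseteq> {\<alpha>} \<times> fock_monomials (i + N)"
    using sub \<open>i \<ge> 1\<close> unfolding j by simp
qed

lemma keys_fock_word:
  assumes "\<forall>(h, i)\<in>set w. i \<ge> 1" and x: "Poly_Mapping.keys x \<subseteq> {\<alpha>} \<times> fock_monomials N"
  shows "Poly_Mapping.keys (fock_word f w x) \<subseteq> {\<alpha>} \<times> fock_monomials ((\<Sum>(h, i)\<leftarrow>w. i) + N)"
  using assms(1)
proof (induction w)
  case Nil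
  show ?case using x by simp
next
  case (Cons a w)
  then show ?case
    using keys_fock_heis_creation[of "fock_word f w x" \<alpha> "(\<Sum>(h, i)\<leftarrow>w. i) + N" "snd a" f "fst a"]
    by (cases a) (simp add: add.assoc)
qed

text \<open>
  A graded piece is nonzero only if some product of creation operators realises its weight. That
  product fixes the levels \<open>n\<close> and \<open>m\<close> for all other generators of the same piece, so the monomials
  of a single level support the whole piece.
\<close>

lemma fock_graded_nonzeroD:
  assumes "a \<in> fock_graded p f \<alpha> s t" "a \<noteq> 0"
  obtains n m where "s = f (p \<alpha>) (p \<alpha>) / 2 + real n" "t = f (co p \<alpha>) (co p \<alpha>) / 2 + real m"
    "Poly_Mapping.keys a \<subseteq> {\<alpha>} \<times> fock_monomials (n + m)"
proof -
  have C: "vector_space ((*) :: complex \<Rightarrow> _)" by unfold_locales (auto simp: algebra_simps)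
  interpret vector_space "fock_scale :: _ \<Rightarrow> 'a fock \<Rightarrow> _" by (rule vector_space_pm_scale[OF C])
  define G where "G = {fock_word f hs (fock_word f gs (fock_e \<alpha>)) | hs gs.
        (\<forall>(h, i) \<in> set hs. co p h = 0 \<and> i \<ge> 1) \<and>
        (\<forall>(g, i) \<in> set gs. p g = 0 \<and> i \<ge> 1) \<and>
        s = f (p \<alpha>) (p \<alpha>) / 2 + real (\<Sum>(h, i)\<leftarrow>hs. i) \<and>
        t = f (co p \<alpha>) (co p \<alpha>) / 2 + real (\<Sum>(g, i)\<leftarrow>gs. i)}"
  have a: "a \<in> span G" using assms(1) by (simp add: fock_graded_def G_def)
  then have "G \<noteq> {}" using assms(2) by auto
  then obtain n m where nm: "s = f (p \<alpha>) (p \<alpha>) / 2 + real n" "t = f (co p \<alpha>) (co p \<alpha>) / 2 + real m"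
    unfolding G_def by blast
  have "G \<subseteq> {x. Poly_Mapping.keys x \<subseteq> {\<alpha>} \<times> fock_monomials (n + m)}"
  proof
    fix x assume "x \<in> G"
    then obtain hs gs where x: "x = fock_word f hs (fock_word f gs (fock_e \<alpha>))"
      and "\<forall>(h, i) \<in> set hs. co p h = 0 \<and> i \<ge> 1" "\<forall>(g, i) \<in> set gs. p g = 0 \<and> i \<ge> 1"
      and s: "s = f (p \<alpha>) (p \<alpha>) / 2 + real (\<Sum>(h, i)\<leftarrow>hs. i)"
      and t: "t = f (co p \<alpha>) (co p \<alpha>) / 2 + real (\<Sum>(g, i)\<leftarrow>gs. i)"
      unfolding G_def by blast
    then have "\<forall>(h, i) \<in> set hs. i \<ge> 1" "\<forall>(g, i) \<in> set gs. i \<ge> 1" by auto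
    moreover have "(\<Sum>(h, i)\<leftarrow>hs. i) = n" "(\<Sum>(g, i)\<leftarrow>gs. i) = m"
      using s t unfolding nm by simp_all
    moreover note x
    moreover have "Poly_Mapping.keys (fock_e \<alpha>) \<subseteq> {\<alpha>} \<times> fock_monomials 0"
      by (simp add: fock_e_def fock_monomials_def)
    ultimately show "x \<in> {x. Poly_Mapping.keys x \<subseteq> {\<alpha>} \<times> fock_monomials (n + m)}"
      using keys_fock_word[of hs "fock_word f gs (fock_e \<alpha>)" \<alpha> m f] keys_fock_word[of gs "fock_e \<alpha>" \<alpha> 0 f]
      by simp
  qed
  then have "span G \<subseteq> {x. Poly_Mapping.keys x \<subseteq> {\<alpha>} \<times> fock_monomials (n + m)}"
    by (rule span_minimal) (rule subspace_keys_subset[OF C])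
  then show ?thesis using that nm a by blast
qed

lemma lookup_tensor:
  assumes "vector_space (scal V)"
  shows "Poly_Mapping.lookup (tensor V a b) k = scal V (Poly_Mapping.lookup a k) b"
proof -
  interpret vector_space "scal V" by fact
  show ?thesis by (simp add: tensor_def Poly_Mapping.map.rep_eq when_def)
qed

section \<open>The forms and the weights of a full H-vertex algebra\<close>

lemma linear_co: "linear p \<Longrightarrow> linear (co p)"
  unfolding co_def[abs_def] by (rule linear_compose_sub) (simp_all add: linear_id[unfolded id_def])

lemma bilinear_nondeg_sym_form_compose:
  assumes "nondeg_sym_form (range q) b" "linear q"
  shows "bilinear (\<lambda>x y. b (q x) (q y))"
proof -
  have b: "b (q x) (q y) = b (q y) (q x)" "b (q x + q y) (q z) = b (q x) (q z) + b (q y) (q z)"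
    "b (c *\<^sub>R q x) (q y) = c * b (q x) (q y)" for x y z c
    using assms(1) by (simp_all add: nondeg_sym_form_def)
  have l: "linear (\<lambda>x. b (q x) (q y))" for y
    by (rule linearI) (simp_all add: linear_add[OF assms(2)] linear_cmul[OF assms(2)] b)
  moreover have "linear (\<lambda>y. b (q x) (q y))" for x
    using l[of x] by (subst b(1))
  ultimately show ?thesis by (simp add: bilinear_def)
qed

context
  fixes V :: "('v::ab_group_add, 'h::real_vector) full_H_va"
  assumes V: "full_H_vertex_algebra V"
begin

lemma vector_space_scal: "vector_space (scal V)"
  using V by (simp only: full_H_vertex_algebra_def full_vertex_algebra_def graded_space_def)

lemma subspace_grade: "module.subspace (scal V) (grade V h k)"
  using V by (simp only: full_H_vertex_algebra_def full_vertex_algebra_def graded_space_def)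

lemma subspace_carr: "module.subspace (scal V) (carr V)"
  using V unfolding full_H_vertex_algebra_def full_vertex_algebra_def graded_space_def
  by (elim conjE)

lemma grade_subset_carr: "grade V h k \<subseteq> carr V"
proof -
  interpret vector_space "scal V" by (rule vector_space_scal)
  have "carr V = span (\<Union>h k. grade V h k)"
    using V by (simp only: full_H_vertex_algebra_def full_vertex_algebra_def graded_space_def)
  then show ?thesis by (auto intro: span_base)
qed

lemma linear_proj: "linear (proj V)"
  using V by (simp only: full_H_vertex_algebra_def)

lemma proj_idem: "proj V (proj V h) = proj V h"
  using V by (simp only: full_H_vertex_algebra_def)

lemma co_proj_simps:
  "proj V (co (proj V) h) = 0" "co (proj V) (proj V h) = 0" "co (proj V) (co (proj V) h) = co (proj V) h"
  by (simp_all add: co_def linear_diff[OF linear_proj] proj_idem)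

lemma Hl_iff: "h \<in> Hl V \<longleftrightarrow> proj V h = h"
  unfolding Hl_def by (metis proj_idem rangeE rangeI)

lemma Hr_iff: "h \<in> Hr V \<longleftrightarrow> proj V h = 0"
proof
  assume "h \<in> Hr V"
  then show "proj V h = 0" unfolding Hr_def using co_proj_simps(1) by auto
next
  assume "proj V h = 0"
  then have "h = co (proj V) h" by (simp add: co_def)
  then show "h \<in> Hr V" unfolding Hr_def by (rule range_eqI)
qed

lemma nondeg_sym_form_l: "nondeg_sym_form (Hl V) (form_l V)"
  using V by (simp only: full_H_vertex_algebra_def)

lemma nondeg_sym_form_r: "nondeg_sym_form (Hr V) (form_r V)"
  using V by (simp only: full_H_vertex_algebra_def)

lemma bilinear_form_l: "bilinear (\<lambda>x y. form_l V (proj V x) (proj V y))"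
  using nondeg_sym_form_l linear_proj unfolding Hl_def by (rule bilinear_nondeg_sym_form_compose)

lemma bilinear_form_r: "bilinear (\<lambda>x y. form_r V (co (proj V) x) (co (proj V) y))"
  using nondeg_sym_form_r linear_co[OF linear_proj] unfolding Hr_def
  by (rule bilinear_nondeg_sym_form_compose)

lemma form_l_commute: "form_l V (proj V x) (proj V y) = form_l V (proj V y) (proj V x)"
  using nondeg_sym_form_l unfolding nondeg_sym_form_def Hl_def by simp

lemma form_r_commute:
  "form_r V (co (proj V) x) (co (proj V) y) = form_r V (co (proj V) y) (co (proj V) x)"
  using nondeg_sym_form_r unfolding nondeg_sym_form_def Hr_def by simp

lemma form_l_0: "form_l V 0 0 = 0"
  using bilinear_lzero[OF bilinear_form_l, of 0] by (simp add: linear_0[OF linear_proj])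

lemma form_r_0: "form_r V 0 0 = 0"
  using bilinear_lzero[OF bilinear_form_r, of 0] by (simp add: linear_0[OF linear_co[OF linear_proj]])

lemma heis_mode_linear:
  assumes "h \<in> Hl V \<union> Hr V" "v \<in> carr V" "w \<in> carr V"
  shows "heis_mode V h n (v + w) = heis_mode V h n v + heis_mode V h n w"
    and "heis_mode V h n (scal V c v) = scal V c (heis_mode V h n v)"
proof -
  interpret vector_space "scal V" by (rule vector_space_scal)
  have full: "full_vertex_algebra V" using V by (simp only: full_H_vertex_algebra_def)
  have "\<forall>h\<in>Hl V. emb V h \<in> grade V 1 0 \<and> Dbar_op V (emb V h) = 0"
    using V unfolding full_H_vertex_algebra_def by (elim conjE)
  moreover have "\<forall>h\<in>Hr V. emb V h \<in> grade V 0 1 \<and> D_op V (emb V h) = 0"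
    using V unfolding full_H_vertex_algebra_def by (elim conjE)
  ultimately have e: "emb V (proj V h) \<in> carr V" "emb V (co (proj V) h) \<in> carr V"
    using grade_subset_carr[of 1 0] grade_subset_carr[of 0 1] unfolding Hl_def Hr_def by auto
  have add: "\<forall>a\<in>carr V. \<forall>b\<in>carr V. \<forall>b'\<in>carr V. \<forall>s t.
        Ycoeff V a s t (b + b') = Ycoeff V a s t b + Ycoeff V a s t b' \<and>
        Ycoeff V (b + b') s t a = Ycoeff V b s t a + Ycoeff V b' s t a"
    using full unfolding full_vertex_algebra_def by (elim conjE)
  have scl: "\<forall>a\<in>carr V. \<forall>b\<in>carr V. \<forall>c s t.
        Ycoeff V a s t (scal V c b) = scal V c (Ycoeff V a s t b) \<and>
        Ycoeff V (scal V c a) s t b = scal V c (Ycoeff V a s t b)"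
    using full unfolding full_vertex_algebra_def by (elim conjE)
  show "heis_mode V h n (v + w) = heis_mode V h n v + heis_mode V h n w"
    "heis_mode V h n (scal V c v) = scal V c (heis_mode V h n v)"
    using add scl e assms(2,3) by (simp_all add: heis_mode_def mode_def scale_right_distrib)
qed

text \<open>
  The forms on \<open>H\<^sub>l\<close> and \<open>H\<^sub>r\<close> are nondegenerate, so distinct \<open>\<alpha>\<close> give distinct joint eigenvalues of the
  zero modes, and a finite-dimensional space contains eigenvectors for only finitely many of
  them.
\<close>

lemma finite_weights:
  assumes "finite B" "grade V h k \<subseteq> module.span (scal V) B"
  shows "finite {\<alpha>. \<exists>v\<in>grade V h k \<inter> weight_space V \<alpha>. v \<noteq> 0}"
proof -
  interpret vector_space "scal V" by (rule vector_space_scal)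
  define ev where "ev \<alpha> x = complex_of_real
    (if x \<in> Hl V then form_l V x (proj V \<alpha>) else form_r V x (co (proj V) \<alpha>))" for \<alpha> x
  show ?thesis
  proof (rule finite_joint_eigenvalues[where X = "Hl V \<union> Hr V" and C = "carr V"
        and T = "\<lambda>x. heis_mode V x 0" and ev = ev, OF assms subspace_carr])
    fix \<alpha> \<beta> :: 'h assume "\<alpha> \<noteq> \<beta>"
    show "\<exists>x\<in>Hl V \<union> Hr V. ev \<alpha> x \<noteq> ev \<beta> x"
    proof (cases "proj V \<alpha> = proj V \<beta>")
      case False
      then have "proj V (\<alpha> - \<beta>) \<noteq> 0" by (simp add: linear_diff[OF linear_proj])
      moreover have "proj V (\<alpha> - \<beta>) \<in> Hl V" by (simp add: Hl_def)
      ultimately obtain y where y: "y \<in> Hl V" "form_l V (proj V (\<alpha> - \<beta>)) y \<noteq> 0"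
        using nondeg_sym_form_l unfolding nondeg_sym_form_def by blast
      then have "form_l V (proj V (\<alpha> - \<beta>)) (proj V y) \<noteq> 0" by (simp add: Hl_iff)
      then have "form_l V (proj V y) (proj V \<alpha>) \<noteq> form_l V (proj V y) (proj V \<beta>)"
        using bilinear_lsub[OF bilinear_form_l, of \<alpha> \<beta> y] by (simp add: form_l_commute[of _ y])
      then show ?thesis using y(1) by (intro bexI[of _ y]) (simp_all add: ev_def Hl_iff)
    next
      case True
      then have "co (proj V) (\<alpha> - \<beta>) \<noteq> 0"
        using \<open>\<alpha> \<noteq> \<beta>\<close> by (simp add: co_def linear_diff[OF linear_proj])
      moreover have "co (proj V) (\<alpha> - \<beta>) \<in> Hr V" by (simp add: Hr_def)
      ultimately obtain y where y: "y \<in> Hr V" "form_r V (co (proj V) (\<alpha> - \<beta>)) y \<noteq> 0"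
        using nondeg_sym_form_r unfolding nondeg_sym_form_def by blast
      have cy: "co (proj V) y = y" using y(1) by (simp add: Hr_iff co_def)
      have "form_r V (co (proj V) (\<alpha> - \<beta>)) (co (proj V) y) \<noteq> 0" unfolding cy by (rule y(2))
      then have ne: "form_r V (co (proj V) y) (co (proj V) \<alpha>) \<noteq> form_r V (co (proj V) y) (co (proj V) \<beta>)"
        using bilinear_lsub[OF bilinear_form_r, of \<alpha> \<beta> y] by (simp add: form_r_commute[of _ y])
      have "y \<notin> Hl V"
      proof
        assume "y \<in> Hl V"
        then have "y = 0" using y(1) by (simp add: Hl_iff Hr_iff)
        then show False using ne bilinear_lzero[OF bilinear_form_r] by simp
      qed
      then show ?thesis using y(1) ne by (intro bexI[of _ y]) (simp_all add: ev_def cy)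
    qed
  next
    fix \<alpha> assume "\<alpha> \<in> {\<alpha>. \<exists>v\<in>grade V h k \<inter> weight_space V \<alpha>. v \<noteq> 0}"
    then obtain v where v: "v \<in> grade V h k" "v \<in> weight_space V \<alpha>" "v \<noteq> 0" by blast
    have "heis_mode V x 0 v = scal V (ev \<alpha> x) v" if "x \<in> Hl V \<union> Hr V" for x
      using that v(2) by (auto simp: ev_def weight_space_def)
    then show "\<exists>v\<in>grade V h k \<inter> carr V. v \<noteq> 0 \<and> (\<forall>x\<in>Hl V \<union> Hr V. heis_mode V x 0 v = scal V (ev \<alpha> x) v)"
      using v(1,3) grade_subset_carr by (intro bexI[of _ v]) auto
  qed (use heis_mode_linear in auto)
qed

section \<open>The deformed forms\<close>

text \<open>
  Since \<open>p = \<sigma> p\<^sub>0 \<sigma>\<^sup>-\<^sup>1\<close> and \<open>\<sigma>\<close> preserves the lattice form, transport by \<open>\<sigma>\<close> identifies the two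
  parts of \<open>(-,-)\<^sub>p\<close> at \<open>\<alpha>\<close> with the original left and right forms at \<open>\<sigma>\<^sup>-\<^sup>1 \<alpha>\<close>.
\<close>

lemma deform_proj_norms:
  fixes \<sigma> :: "'h \<Rightarrow> 'h"
  assumes \<sigma>: "lat_orthogonal V \<sigma>"
  defines "p \<equiv> deform_proj V \<sigma>" and "\<tau> \<equiv> inv \<sigma>"
  shows "p_form V p (p \<alpha>) (p \<alpha>) = form_l V (proj V (\<tau> \<alpha>)) (proj V (\<tau> \<alpha>))"
    and "p_form V p (co p \<alpha>) (co p \<alpha>) = form_r V (co (proj V) (\<tau> \<alpha>)) (co (proj V) (\<tau> \<alpha>))"
proof -
  have lin: "linear \<sigma>" and bij: "bij \<sigma>"
    and lat: "lat_form V (\<sigma> x) (\<sigma> y) = lat_form V x y" for x y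
    using \<sigma> by (auto simp: lat_orthogonal_def)
  have st: "\<sigma> (\<tau> x) = x" "\<tau> (\<sigma> x) = x" for x
    using bij by (simp_all add: \<tau>_def bij_is_surj surj_f_inv_f bij_is_inj)
  have p: "p x = \<sigma> (proj V (\<tau> x))" for x by (simp add: p_def \<tau>_def deform_proj_def)
  have cp: "co p x = \<sigma> (co (proj V) (\<tau> x))" for x
    by (simp add: co_def p linear_diff[OF lin] st)
  have z: "\<sigma> 0 = 0" by (rule linear_0[OF lin])
  have latz: "lat_form V 0 0 = 0"
    using bilinear_lzero[OF bilinear_form_l] bilinear_lzero[OF bilinear_form_r] by (simp add: lat_form_def)
  show "p_form V p (p \<alpha>) (p \<alpha>) = form_l V (proj V (\<tau> \<alpha>)) (proj V (\<tau> \<alpha>))"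
    unfolding p_form_def p cp st proj_idem co_proj_simps z latz lat
    by (simp add: lat_form_def proj_idem co_proj_simps form_r_0)
  show "p_form V p (co p \<alpha>) (co p \<alpha>) = form_r V (co (proj V) (\<tau> \<alpha>)) (co (proj V) (\<tau> \<alpha>))"
    unfolding p_form_def p cp st proj_idem co_proj_simps z latz lat
    by (simp add: lat_form_def proj_idem co_proj_simps form_l_0)
qed

lemma positive_deform:
  assumes pos: "positive_va V" and \<sigma>: "lat_orthogonal V \<sigma>"
  shows "positive_va (deform V \<sigma>)"
proof -
  let ?p = "deform_proj V \<sigma>"
  have lin: "linear \<sigma>" using \<sigma> by (simp add: lat_orthogonal_def)
  have l: "p_form V ?p (?p x) (?p x) > 0" if "?p x \<noteq> 0" for x
  proof -
    have "proj V (inv \<sigma> x) \<noteq> 0"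
      using that linear_0[OF lin] by (auto simp: deform_proj_def)
    then show ?thesis
      using pos unfolding deform_proj_norms[OF \<sigma>] positive_va_def Hl_def by blast
  qed
  have r: "p_form V ?p (co ?p x) (co ?p x) > 0" if "co ?p x \<noteq> 0" for x
  proof -
    have "x = \<sigma> (inv \<sigma> x)"
      using \<sigma> by (simp add: lat_orthogonal_def bij_is_surj surj_f_inv_f)
    then have "co ?p x = \<sigma> (co (proj V) (inv \<sigma> x))"
      by (simp add: co_def deform_proj_def linear_diff[OF lin])
    then have "co (proj V) (inv \<sigma> x) \<noteq> 0"
      using that linear_0[OF lin] by auto
    then show ?thesis
      using pos unfolding deform_proj_norms[OF \<sigma>] positive_va_def Hr_def by blast
  qed
  show ?thesis
    unfolding positive_va_def Hl_def Hr_def deform_def deform_with_def using l r by auto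
qed

end

section \<open>Compactness of the deformation\<close>

lemma span_neq_0_generator:
  assumes "vector_space sc" "module.span sc G \<noteq> {0}"
  obtains x where "x \<in> G" "x \<noteq> 0"
proof -
  interpret vector_space sc by fact
  have "\<not> G \<subseteq> {0}"
  proof
    assume "G \<subseteq> {0}"
    then have "span G \<subseteq> {0}" by (rule span_minimal) (rule subspace_single_0)
    then show False using assms(2) span_zero[of G] by blast
  qed
  then show ?thesis using that by blast
qed

definition deform_generators ::
  "('v::ab_group_add, 'h::real_vector) full_H_va \<Rightarrow> ('h \<Rightarrow> 'h) \<Rightarrow> real \<Rightarrow> real
    \<Rightarrow> ('v, 'h) deform_space set" where
  "deform_generators V p h k = (\<Union>\<alpha> s t. {tensor V a b | a b.
     a \<in> fock_graded p (p_form V p) \<alpha> s t \<and> b \<in> vac_space_graded V \<alpha> (h - s) (k - t)})"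

lemma deform_grade_eq_span:
  "deform_grade V p h k = module.span (pm_scale (scal V)) (deform_generators V p h k)"
  by (simp only: deform_grade_def deform_generators_def)

context
  fixes V :: "('v::ab_group_add, 'h::real_vector) full_H_va"
  assumes V: "full_H_vertex_algebra V"
begin

text \<open>
  The weight of a nonzero pure tensor splits into nonnegative contributions: the weight \<open>(t, t')\<close> of
  the vacuum vector, the lowest Fock weight, and the oscillator levels \<open>(n, m)\<close>. The charge is
  written \<open>\<sigma> \<beta>\<close> because the lowest Fock weight of charge \<open>\<sigma> \<beta>\<close> in the deformed theory is the
  undeformed one of charge \<open>\<beta>\<close>.
\<close>

lemma deform_generator_nonzeroD:
  assumes \<sigma>: "lat_orthogonal V \<sigma>"
    and nonneg: "\<And>\<alpha> t t'. t < 0 \<or> t' < 0 \<Longrightarrow> vac_space_graded V \<alpha> t t' = {0}"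
    and x: "x \<in> deform_generators V (deform_proj V \<sigma>) h k" "x \<noteq> 0"
  obtains t t' \<beta> n m b where
    "0 \<le> t" "0 \<le> t'"
    "h = t + form_l V (proj V \<beta>) (proj V \<beta>) / 2 + real n"
    "k = t' + form_r V (co (proj V) \<beta>) (co (proj V) \<beta>) / 2 + real m"
    "Poly_Mapping.keys x \<subseteq> {\<sigma> \<beta>} \<times> fock_monomials (n + m)"
    "b \<in> vac_space_graded V (\<sigma> \<beta>) t t'" "b \<noteq> 0"
    "\<forall>i. \<exists>c. Poly_Mapping.lookup x i = scal V c b"
proof -
  let ?p = "deform_proj V \<sigma>"
  note vs = vector_space_scal[OF V]
  interpret vector_space "scal V" by (rule vs)
  obtain \<alpha> s s' a b where x_eq: "x = tensor V a b"
    and a: "a \<in> fock_graded ?p (p_form V ?p) \<alpha> s s'"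
    and b: "b \<in> vac_space_graded V \<alpha> (h - s) (k - s')"
    using x(1) unfolding deform_generators_def by blast
  have lookup: "Poly_Mapping.lookup x i = scal V (Poly_Mapping.lookup a i) b" for i
    unfolding x_eq by (rule lookup_tensor[OF vs])
  have "a \<noteq> 0"
  proof
    assume "a = 0"
    then have "x = 0" by (intro poly_mapping_eqI) (simp add: lookup)
    then show False using x(2) by simp
  qed
  have "b \<noteq> 0"
  proof
    assume "b = 0"
    then have "x = 0" by (intro poly_mapping_eqI) (simp add: lookup)
    then show False using x(2) by simp
  qed
  define \<beta> where "\<beta> = inv \<sigma> \<alpha>"
  have \<alpha>: "\<sigma> \<beta> = \<alpha>"
    using \<sigma> by (simp add: \<beta>_def lat_orthogonal_def bij_is_surj surj_f_inv_f)
  obtain n m where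
    s: "s = form_l V (proj V \<beta>) (proj V \<beta>) / 2 + real n"
    and s': "s' = form_r V (co (proj V) \<beta>) (co (proj V) \<beta>) / 2 + real m"
    and keys: "Poly_Mapping.keys a \<subseteq> {\<alpha>} \<times> fock_monomials (n + m)"
    by (rule fock_graded_nonzeroD[OF a \<open>a \<noteq> 0\<close>, unfolded deform_proj_norms[OF V \<sigma>], folded \<beta>_def])
  have "\<not> (h - s < 0 \<or> k - s' < 0)"
    using nonneg[of "h - s" "k - s'" \<alpha>] b \<open>b \<noteq> 0\<close> by blast
  then have pos: "0 \<le> h - s" "0 \<le> k - s'" by simp_all
  have keys_x: "Poly_Mapping.keys x \<subseteq> {\<sigma> \<beta>} \<times> fock_monomials (n + m)"
    using keys keys_map_subset[of "\<lambda>c. scal V c b" a] unfolding x_eq tensor_def \<alpha>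
    by (rule order_trans[rotated])
  show ?thesis
  proof (rule that[OF pos _ _ keys_x])
    show "h = h - s + form_l V (proj V \<beta>) (proj V \<beta>) / 2 + real n" using s by simp
    show "k = k - s' + form_r V (co (proj V) \<beta>) (co (proj V) \<beta>) / 2 + real m" using s' by simp
    show "b \<in> vac_space_graded V (\<sigma> \<beta>) (h - s) (k - s')" unfolding \<alpha> by (rule b)
    show "\<forall>i. \<exists>c. Poly_Mapping.lookup x i = scal V c b" using lookup by blast
  qed fact
qed

text \<open>
  Discreteness rests on a bound for the charges. A vacuum vector of charge \<open>\<sigma> \<beta>\<close> has total weight
  \<open>t + t' + E(\<sigma> \<beta>, \<sigma> \<beta>)/2\<close> in \<open>V\<close> and enters the deformation with \<open>t + t' + E(\<beta>, \<beta>)/2\<close>, where \<open>E\<close> is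
  the positive-definite sum of the two forms. As \<open>t\<close>, \<open>t'\<close> are nonnegative, a bound on the second
  weight bounds \<open>E(\<beta>, \<beta>)\<close>, hence \<open>E(\<sigma> \<beta>, \<sigma> \<beta>)\<close>, hence the first weight; discreteness of \<open>V\<close> then
  leaves finitely many charges and vacuum weights.
\<close>

lemma compact_deform:
  assumes nonneg: "\<And>\<alpha> t t'. t < 0 \<or> t' < 0 \<Longrightarrow> vac_space_graded V \<alpha> t t' = {0}"
    and pos: "positive_va V" and compact: "compact_va V" and \<sigma>: "lat_orthogonal V \<sigma>"
  shows "compact_va (deform V \<sigma>)"
proof -
  define p where "p = deform_proj V \<sigma>"
  define Ql where "Ql \<alpha> = form_l V (proj V \<alpha>) (proj V \<alpha>)" for \<alpha>
  define Qr where "Qr \<alpha> = form_r V (co (proj V) \<alpha>) (co (proj V) \<alpha>)" for \<alpha>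
  define E where "E x y = form_l V (proj V x) (proj V y) + form_r V (co (proj V) x) (co (proj V) y)" for x y
  note vs = vector_space_scal[OF V]
  interpret V: vector_space "scal V" by (rule vs)
  interpret P: vector_space "pm_scale (scal V) :: _ \<Rightarrow> ('v, 'h) deform_space \<Rightarrow> _"
    by (rule vector_space_pm_scale[OF vs])
  have sel: "scal (deform V \<sigma>) = pm_scale (scal V)" "grade (deform V \<sigma>) = deform_grade V p"
    by (simp_all add: deform_def deform_with_def p_def)
  have lin: "linear \<sigma>" and bij: "bij \<sigma>" using \<sigma> by (simp_all add: lat_orthogonal_def)
  have Ql_pos: "proj V \<alpha> \<noteq> 0 \<Longrightarrow> Ql \<alpha> > 0" and Qr_pos: "co (proj V) \<alpha> \<noteq> 0 \<Longrightarrow> Qr \<alpha> > 0" for \<alpha>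
    using pos unfolding positive_va_def Hl_def Hr_def Ql_def Qr_def by blast+
  have Ql0: "Ql \<alpha> \<ge> 0" for \<alpha> using Ql_pos[of \<alpha>] form_l_0[OF V] by (cases "proj V \<alpha> = 0") (auto simp: Ql_def)
  have Qr0: "Qr \<alpha> \<ge> 0" for \<alpha> using Qr_pos[of \<alpha>] form_r_0[OF V] by (cases "co (proj V) \<alpha> = 0") (auto simp: Qr_def)
  note gen = deform_generator_nonzeroD[OF \<sigma> nonneg, folded p_def, folded Ql_def Qr_def]
  have "bounded_below_va (deform V \<sigma>)"
    unfolding bounded_below_va_def sel
  proof (intro exI allI impI)
    fix h k :: real assume hk: "h \<le> - 1 \<or> k \<le> - 1"
    show "deform_grade V p h k = {0}"
    proof (rule ccontr)
      assume "deform_grade V p h k \<noteq> {0}"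
      then obtain x where x: "x \<in> deform_generators V p h k" "x \<noteq> 0"
        unfolding deform_grade_eq_span by (rule span_neq_0_generator[OF P.vector_space_axioms])
      obtain t t' \<beta> n m where "0 \<le> t" "0 \<le> t'"
        "h = t + Ql \<beta> / 2 + real n" "k = t' + Qr \<beta> / 2 + real m"
        by (rule gen[OF _ x])
      then show False using hk Ql0[of \<beta>] Qr0[of \<beta>] by linarith
    qed
  qed
  moreover have "discrete_va (deform V \<sigma>)"
  proof -
    have bil: "bilinear E"
      using bilinear_form_l[OF V] bilinear_form_r[OF V] unfolding bilinear_def E_def
      by (auto intro: linear_compose_add)
    have fin: "\<exists>B::'h set. finite B \<and> span B = UNIV"
      using V unfolding full_H_vertex_algebra_def by (elim conjE)
    obtain C where C: "C \<ge> 0" "E (\<sigma> \<beta>) (\<sigma> \<beta>) \<le> C * E \<beta> \<beta>" for \<beta>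
    proof -
      have "bilinear (\<lambda>x y. E (\<sigma> x) (\<sigma> y))"
        using bil lin unfolding bilinear_def by (auto intro: linear_compose[unfolded o_def])
      moreover have sym: "E x y = E y x" for x y
        unfolding E_def form_l_commute[OF V, of x y] form_r_commute[OF V, of x y] ..
      moreover have pd: "E x x > 0" if "x \<noteq> 0" for x
      proof -
        have "proj V x \<noteq> 0 \<or> co (proj V) x \<noteq> 0" using that by (auto simp: co_def)
        then show ?thesis
          using Ql_pos[of x] Qr_pos[of x] Ql0[of x] Qr0[of x] unfolding E_def Ql_def Qr_def by linarith
      qed
      ultimately have "\<exists>C\<ge>0. \<forall>x. E (\<sigma> x) (\<sigma> x) \<le> C * E x x"
        by (intro form_le_pos_def_form[OF fin _ bil])
      then show ?thesis using that by blast
    qed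
    have V_discrete: "finite {(h, k). h + k < K \<and> grade V h k \<noteq> {0}}"
      "h + k < K \<Longrightarrow> \<exists>B. finite B \<and> grade V h k \<subseteq> V.span B" for K h k
      using compact unfolding compact_va_def discrete_va_iff[OF vs subspace_grade[OF V]] by blast+
    have "finite {(h, k). h + k < K \<and> deform_grade V p h k \<noteq> {0}}" (is ?fin)
      and "\<And>h k. h + k < K \<Longrightarrow> \<exists>B. finite B \<and> deform_grade V p h k \<subseteq> P.span B" for K
    proof -
      (* A nonzero generator of total weight below K is built on a vacuum vector of V of total
         weight below K'. *)
      define K' where "K' = K + C * K"
      define N where "N = nat \<lceil>K\<rceil>"
      define S where "S = {(h, k). h + k < K' \<and> grade V h k \<noteq> {0}}"
      define W where "W = (\<lambda>(h, k). {\<beta>. \<exists>v\<in>grade V h k \<inter> weight_space V (\<sigma> \<beta>). v \<noteq> 0})"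
      (* The pairs of a weight in V and a charge (as its preimage under sigma) that a vacuum vector
         can contribute. That there are finitely many is the point of the proof. *)
      define T where "T = (SIGMA hk:S. W hk)"
      have "finite S" unfolding S_def by (rule V_discrete(1))
      have "\<forall>hk\<in>S. \<exists>B. finite B \<and> grade V (fst hk) (snd hk) \<subseteq> V.span B"
        unfolding S_def using V_discrete(2)[of _ _ K'] by (auto split: prod.splits)
      from bchoice[OF this] obtain B where
        B: "\<And>h k. (h, k) \<in> S \<Longrightarrow> finite (B (h, k)) \<and> grade V h k \<subseteq> V.span (B (h, k))"
        by fastforce
      have "finite (W hk)" if hk: "hk \<in> S" for hk
      proof -
        obtain h k where [simp]: "hk = (h, k)" by (cases hk)
        have "finite {\<alpha>. \<exists>v\<in>grade V h k \<inter> weight_space V \<alpha>. v \<noteq> 0}"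
          using B hk by (intro finite_weights[OF V, of "B hk"]) auto
        then have "finite (\<sigma> -` {\<alpha>. \<exists>v\<in>grade V h k \<inter> weight_space V \<alpha>. v \<noteq> 0})"
          using bij by (intro finite_vimageI bij_is_inj)
        then show ?thesis by (simp add: W_def vimage_def)
      qed
      with \<open>finite S\<close> have "finite T" unfolding T_def by (rule finite_SigmaI)
      have nonzero: "\<exists>h' k' \<beta> n m. ((h', k'), \<beta>) \<in> T \<and> n + m \<le> N \<and>
          h = h' - Ql (\<sigma> \<beta>) / 2 + Ql \<beta> / 2 + real n \<and>
          k = k' - Qr (\<sigma> \<beta>) / 2 + Qr \<beta> / 2 + real m \<and>
          Poly_Mapping.keys x \<subseteq> {\<sigma> \<beta>} \<times> fock_monomials (n + m) \<and>
          (\<forall>i. Poly_Mapping.lookup x i \<in> grade V h' k')"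
        if x: "x \<in> deform_generators V p h k" "x \<noteq> 0" and hk: "h + k < K" for x h k
      proof -
        obtain t t' \<beta> n m b where t: "0 \<le> t" "0 \<le> t'"
          and h: "h = t + Ql \<beta> / 2 + real n" and k: "k = t' + Qr \<beta> / 2 + real m"
          and keys: "Poly_Mapping.keys x \<subseteq> {\<sigma> \<beta>} \<times> fock_monomials (n + m)"
          and b: "b \<in> vac_space_graded V (\<sigma> \<beta>) t t'" "b \<noteq> 0"
          and lookup: "\<forall>i. \<exists>c. Poly_Mapping.lookup x i = scal V c b"
          by (rule gen[OF _ x])
        define h' where "h' = t + Ql (\<sigma> \<beta>) / 2"
        define k' where "k' = t' + Qr (\<sigma> \<beta>) / 2"
        have b': "b \<in> grade V h' k'" "b \<in> weight_space V (\<sigma> \<beta>)"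
          using b(1) by (simp_all add: vac_space_graded_def vac_space_def Ql_def Qr_def h'_def k'_def)
        have "E \<beta> \<beta> \<le> 2 * K"
          using t hk unfolding h k E_def Ql_def Qr_def by linarith
        then have "E (\<sigma> \<beta>) (\<sigma> \<beta>) \<le> C * (2 * K)"
          using C(2)[of \<beta>] mult_left_mono[OF _ C(1), of "E \<beta> \<beta>" "2 * K"] by linarith
        then have "Ql (\<sigma> \<beta>) / 2 + Qr (\<sigma> \<beta>) / 2 \<le> C * K"
          unfolding E_def Ql_def Qr_def by simp
        moreover have "t + t' < K" "real (n + m) < K"
          using t hk Ql0[of \<beta>] Qr0[of \<beta>] unfolding h k by simp_all
        ultimately have "h' + k' < K'" "real (n + m) \<le> real N"
          unfolding K'_def h'_def k'_def N_def using real_nat_ceiling_ge[of K] by linarith+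
        then have "((h', k'), \<beta>) \<in> T" and "n + m \<le> N"
          unfolding T_def S_def W_def using b' \<open>b \<noteq> 0\<close> by auto
        moreover have "h = h' - Ql (\<sigma> \<beta>) / 2 + Ql \<beta> / 2 + real n"
            "k = k' - Qr (\<sigma> \<beta>) / 2 + Qr \<beta> / 2 + real m"
          unfolding h k h'_def k'_def by simp_all
        moreover have "Poly_Mapping.lookup x i \<in> grade V h' k'" for i
          using lookup[rule_format, of i] V.subspace_scale[OF subspace_grade[OF V] b'(1)] by auto
        ultimately show ?thesis using keys by (intro exI conjI allI)
      qed
      have "{(h, k). h + k < K \<and> deform_grade V p h k \<noteq> {0}} \<subseteq>
          (\<lambda>(((h', k'), \<beta>), n, m). (h' - Ql (\<sigma> \<beta>) / 2 + Ql \<beta> / 2 + real n,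
              k' - Qr (\<sigma> \<beta>) / 2 + Qr \<beta> / 2 + real m)) ` (T \<times> {..N} \<times> {..N})" (is "_ \<subseteq> ?R")
      proof clarify
        fix h k assume hk: "h + k < K" and "deform_grade V p h k \<noteq> {0}"
        then obtain x where x: "x \<in> deform_generators V p h k" "x \<noteq> 0"
          unfolding deform_grade_eq_span by (elim span_neq_0_generator[OF P.vector_space_axioms])
        from nonzero[OF x hk] obtain h' k' \<beta> n m where *: "((h', k'), \<beta>) \<in> T" "n + m \<le> N"
          "h = h' - Ql (\<sigma> \<beta>) / 2 + Ql \<beta> / 2 + real n"
          "k = k' - Qr (\<sigma> \<beta>) / 2 + Qr \<beta> / 2 + real m"
          by blast
        show "(h, k) \<in> ?R"
          by (rule image_eqI[of _ _ "(((h', k'), \<beta>), n, m)"]) (use * in simp_all)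
      qed
      then show ?fin by (rule finite_subset) (use \<open>finite T\<close> in auto)
      (* One finite set spans every graded piece of total weight below K: the pure tensors of the
         Fock monomials in X with the vectors in B'. *)
      define X :: "'h fock_index set" where "X = (\<sigma> ` snd ` T) \<times> (\<Union>j\<le>N. fock_monomials j)"
      define B' where "B' = (\<Union>hk\<in>S. B hk)"
      have "finite X" unfolding X_def
        using \<open>finite T\<close> finite_fock_monomials[OF finite_H_basis[OF fin]] by auto
      have "finite B'" unfolding B'_def using \<open>finite S\<close> B by auto
      fix h k assume hk: "h + k < K"
      let ?G = "(\<lambda>(i, b). Poly_Mapping.single i b) ` (X \<times> B')"
      have "x \<in> P.span ?G" if x: "x \<in> deform_generators V p h k" for x
      proof (cases "x = 0")
        case True
        then show ?thesis by (simp add: P.span_zero)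
      next
        case False
        from nonzero[OF x False hk] obtain h' k' \<beta> n m
          where T: "((h', k'), \<beta>) \<in> T" and "n + m \<le> N"
            and keys: "Poly_Mapping.keys x \<subseteq> {\<sigma> \<beta>} \<times> fock_monomials (n + m)"
            and lookup: "\<And>i. Poly_Mapping.lookup x i \<in> grade V h' k'"
          by blast
        have "\<sigma> \<beta> \<in> \<sigma> ` snd ` T" using T by (auto intro!: image_eqI[of _ _ "((h', k'), \<beta>)"])
        then have "Poly_Mapping.keys x \<subseteq> X" using keys \<open>n + m \<le> N\<close> unfolding X_def by blast
        moreover have "(h', k') \<in> S" using T by (simp add: T_def)
        then have "grade V h' k' \<subseteq> V.span B'"
          using B[of h' k'] V.span_mono[of "B (h', k')" B'] unfolding B'_def by blast
        ultimately show ?thesis using lookup by (intro pm_in_span_single[OF vs]) auto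
      qed
      then have "deform_grade V p h k \<subseteq> P.span ?G"
        unfolding deform_grade_eq_span by (intro P.span_minimal P.subspace_span) auto
      moreover have "finite ?G" using \<open>finite X\<close> \<open>finite B'\<close> by simp
      ultimately show "\<exists>B. finite B \<and> deform_grade V p h k \<subseteq> P.span B" by blast
    qed
    then have "\<forall>K. finite {(h, k). h + k < K \<and> deform_grade V p h k \<noteq> {0}} \<and>
        (\<forall>h k. h + k < K \<longrightarrow> (\<exists>B. finite B \<and> deform_grade V p h k \<subseteq> P.span B))"
      by simp
    moreover have "P.subspace (deform_grade V p h k)" for h k
      unfolding deform_grade_eq_span by (rule P.subspace_span)
    ultimately show ?thesis
      using discrete_va_iff[of "deform V \<sigma>"] P.vector_space_axioms unfolding sel by blast
  qed
  ultimately show ?thesis by (simp add: compact_va_def)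
qed

end

theorem proposition6p3:
  fixes V :: "('v::ab_group_add, 'h::real_vector) full_H_va"
    and \<sigma> :: "'h \<Rightarrow> 'h"
  assumes "full_H_vertex_algebra V"
    and "\<And>\<alpha> t t'. t < 0 \<or> t' < 0 \<Longrightarrow> vac_space_graded V \<alpha> t t' = {0}"
    and "positive_va V"
    and "compact_va V"
    and "lat_orthogonal V \<sigma>"
  shows "positive_va (deform V \<sigma>) \<and> compact_va (deform V \<sigma>)"
  using positive_deform[OF assms(1,3,5)] compact_deform[OF assms] by blast

end
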